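(* Let $\mathcal{A}$ be an abelian category, $n\geq 1$, $I=\{1,\dots,n\}$, let $F=(F_i)_{i\in I}$ be a family of additive right exact endofunctors of $\mathcal{A}$, each admitting a right adjoint, with an associative family $\Phi=(\Phi_{i,j}:F_iF_j\to F_{i+j})$ of natural transformations. Let $P$ be an object of $\mathcal{A}$. An object $(X,f)$ of the right $n$-trivial extension $\mathcal{A}\ltimes_n F$ is in $\mathrm{Add}(T(P))$ if and only if $C(X,f)\in \mathrm{Add}(P)$ and $(X,f)\cong T(C(X,f))$.
   Context: $\Phi$ consists of natural transformations $\Phi_{i,j}:F_iF_j\to F_{i+j}$ for $i,j\in I$ with $i+j\in I$; it is associative if $(\Phi_{i,j+k})_X\circ F_i((\Phi_{j,k})_X)=(\Phi_{i+j,k})_X\circ(\Phi_{i,j})_{F_kX}$ for all objects $X$ and all $i,j,k\in I$ with $i+j+k\in I$. Objects of $\mathcal{A}\ltimes_n F$ are pairs $(X,f)$ with $X$ in $\mathcal{A}$ and $f=(f_i:F_iX\to X)_{i\in I}$ such that for all $i,j\in I$: $f_i\circ F_i(f_j)=f_{i+j}\circ(\Phi_{i,j})_X$ if $i+j\leq n$, and $f_i\circ F_i(f_j)=0$ if $i+j>n$. A morphism $(X,\alpha)\to(Y,\beta)$ is a morphism $\gamma:X\to Y$ in $\mathcal{A}$ with $\gamma\circ\alpha_i=\beta_i\circ F_i(\gamma)$ for all $i$. Functor $T:\mathcal{A}\to\mathcal{A}\ltimes_n F$: $T(X)=(X\oplus\bigoplus_{j\in I}F_jX,\kappa)$, where $\kappa_i:F_iX\oplus\bigoplus_{j\in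 I}F_iF_jX\to X\oplus\bigoplus_{j\in I}F_jX$ maps $F_iX$ identically to the summand $F_iX$, maps $F_iF_jX$ to $F_{i+j}X$ by $(\Phi_{i,j})_X$ if $i+j\leq n$, and has all other components zero; $T(\alpha)=\mathrm{diag}(\alpha,F_1\alpha,\dots,F_n\alpha)$. Functor $C:\mathcal{A}\ltimes_n F\to\mathcal{A}$: $C(X,f)=\operatorname{Coker}\big((f_i)_i:\bigoplus_{i\in I}F_iX\to X\big)$, with the induced maps on morphisms. For an object $Q$ of a category, $\mathrm{Add}(Q)$ is the class of objects isomorphic to direct summands of direct sums of copies of $Q$. *)

theory Defs
  imports "HOL-Algebra.FiniteProduct" "HOL-Library.FuncSet"
begin

section \<open>Categories\<close>

text \<open>
  Both kinds of data are carrier sets inside types; every arrow has a unique source and target, so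
  that the hom-sets of a category are disjoint.
\<close>

record ('o, 'm) category =
  Ob :: "'o set"
  Ar :: "'m set"
  Source :: "'m \<Rightarrow> 'o"
  Target :: "'m \<Rightarrow> 'o"
  Ide :: "'o \<Rightarrow> 'm"
  Comp :: "'m \<Rightarrow> 'm \<Rightarrow> 'm" (infixr "\<cdot>\<index>" 70)

definition Hom :: "('o, 'm, 'x) category_scheme \<Rightarrow> 'o \<Rightarrow> 'o \<Rightarrow> 'm set" where
  "Hom K X Y = {f \<in> Ar K. Source K f = X \<and> Target K f = Y}"

locale category =
  fixes K :: "('o, 'm, 'x) category_scheme" (structure)
  assumes Source_Ob: "f \<in> Ar K \<Longrightarrow> Source K f \<in> Ob K"
    and Target_Ob: "f \<in> Ar K \<Longrightarrow> Target K f \<in> Ob K"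
    and Ide_Hom: "X \<in> Ob K \<Longrightarrow> Ide K X \<in> Hom K X X"
    and Comp_Hom: "\<lbrakk>f \<in> Hom K X Y; g \<in> Hom K Y Z\<rbrakk> \<Longrightarrow> g \<cdot> f \<in> Hom K X Z"
    and Comp_assoc: "\<lbrakk>f \<in> Hom K W X; g \<in> Hom K X Y; h \<in> Hom K Y Z\<rbrakk>
          \<Longrightarrow> (h \<cdot> g) \<cdot> f = h \<cdot> (g \<cdot> f)"
    and Ide_left: "f \<in> Hom K X Y \<Longrightarrow> Ide K Y \<cdot> f = f"
    and Ide_right: "f \<in> Hom K X Y \<Longrightarrow> f \<cdot> Ide K X = f"

definition isomorphic_obs :: "('o, 'm, 'x) category_scheme \<Rightarrow> 'o \<Rightarrow> 'o \<Rightarrow> bool" where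
  "isomorphic_obs K X Y \<longleftrightarrow> X \<in> Ob K \<and> Y \<in> Ob K \<and>
     (\<exists>f \<in> Hom K X Y. \<exists>g \<in> Hom K Y X. g \<cdot>\<^bsub>K\<^esub> f = Ide K X \<and> f \<cdot>\<^bsub>K\<^esub> g = Ide K Y)"

definition is_mono :: "('o, 'm, 'x) category_scheme \<Rightarrow> 'm \<Rightarrow> bool" where
  "is_mono K f \<longleftrightarrow> f \<in> Ar K \<and>
     (\<forall>W \<in> Ob K. \<forall>g \<in> Hom K W (Source K f). \<forall>h \<in> Hom K W (Source K f).
        f \<cdot>\<^bsub>K\<^esub> g = f \<cdot>\<^bsub>K\<^esub> h \<longrightarrow> g = h)"

definition is_epi :: "('o, 'm, 'x) category_scheme \<Rightarrow> 'm \<Rightarrow> bool" where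
  "is_epi K f \<longleftrightarrow> f \<in> Ar K \<and>
     (\<forall>W \<in> Ob K. \<forall>g \<in> Hom K (Target K f) W. \<forall>h \<in> Hom K (Target K f) W.
        g \<cdot>\<^bsub>K\<^esub> f = h \<cdot>\<^bsub>K\<^esub> f \<longrightarrow> g = h)"


section \<open>Direct sums and Add\<close>

text \<open>A direct sum of a possibly infinite family is its coproduct.\<close>

definition is_coproduct ::
    "('o, 'm, 'x) category_scheme \<Rightarrow> 'i set \<Rightarrow> ('i \<Rightarrow> 'o) \<Rightarrow> ('i \<Rightarrow> 'm) \<Rightarrow> 'o \<Rightarrow> bool" where
  "is_coproduct K J X \<iota> Z \<longleftrightarrow> Z \<in> Ob K \<and> (\<forall>j \<in> J. \<iota> j \<in> Hom K (X j) Z) \<and>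
     (\<forall>W \<in> Ob K. \<forall>f. (\<forall>j \<in> J. f j \<in> Hom K (X j) W) \<longrightarrow>
        (\<exists>!h. h \<in> Hom K Z W \<and> (\<forall>j \<in> J. h \<cdot>\<^bsub>K\<^esub> \<iota> j = f j)))"

definition is_direct_summand :: "('o, 'm, 'x) category_scheme \<Rightarrow> 'o \<Rightarrow> 'o \<Rightarrow> bool" where
  "is_direct_summand K X Z \<longleftrightarrow>
     (\<exists>Y \<iota>. is_coproduct K (UNIV :: bool set) (\<lambda>b. if b then X else Y) \<iota> Z)"

text \<open>
  The index set of the direct sum may be any set (including the empty one). Taking it among the sets
  of arrows avoids quantifying over types and loses nothing, as the lemma \<open>AddI\<close> below shows.
  Closure under isomorphism is built in, since coproducts are only determined up to isomorphism.
\<close>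

definition Add :: "('o, 'm, 'x) category_scheme \<Rightarrow> 'o \<Rightarrow> 'o set" where
  "Add K Q = {X \<in> Ob K. \<exists>(S :: 'm set) \<iota> Z.
     is_coproduct K S (\<lambda>_. Q) \<iota> Z \<and> is_direct_summand K X Z}"

lemma coproduct_universal:
  assumes "is_coproduct K J X \<iota> Z" "W \<in> Ob K" "\<And>j. j \<in> J \<Longrightarrow> f j \<in> Hom K (X j) W"
  shows "\<exists>!h. h \<in> Hom K Z W \<and> (\<forall>j \<in> J. h \<cdot>\<^bsub>K\<^esub> \<iota> j = f j)"
  using assms by (simp add: is_coproduct_def)

lemma (in category) coproduct_copies_reindex:
  fixes J :: "'i set"
  assumes Z: "is_coproduct K J (\<lambda>_. Q) \<iota> Z"
  obtains S :: "'m set" and \<iota>' where "is_coproduct K S (\<lambda>_. Q) \<iota>' Z"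
proof (cases "inj_on \<iota> J")
  case True
  have "is_coproduct K (\<iota> ` J) (\<lambda>_. Q) (\<lambda>m. m) Z"
    unfolding is_coproduct_def
  proof (intro conjI ballI allI impI)
    show "Z \<in> Ob K" using Z by (simp add: is_coproduct_def)
    show "m \<in> Hom K Q Z" if "m \<in> \<iota> ` J" for m
      using Z that by (auto simp: is_coproduct_def)
    fix W f assume W: "W \<in> Ob K" and f: "\<forall>m \<in> \<iota> ` J. f m \<in> Hom K Q W"
    have "\<exists>!h. h \<in> Hom K Z W \<and> (\<forall>j \<in> J. h \<cdot> \<iota> j = f (\<iota> j))"
      using f by (intro coproduct_universal[OF Z W]) simp
    then show "\<exists>!h. h \<in> Hom K Z W \<and> (\<forall>m \<in> \<iota> ` J. h \<cdot> m = f m)" by simp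
  qed
  then show ?thesis by (rule that)
next
  case False
  then obtain j k where jk: "j \<in> J" "k \<in> J" "j \<noteq> k" "\<iota> j = \<iota> k" by (auto simp: inj_on_def)
  have single: "g = h" if W: "W \<in> Ob K" and gh: "g \<in> Hom K Q W" "h \<in> Hom K Q W" for W g h
  proof -
    have "\<exists>!u. u \<in> Hom K Z W \<and> (\<forall>l \<in> J. u \<cdot> \<iota> l = (if l = j then g else h))"
      using gh by (intro coproduct_universal[OF Z W]) simp
    then obtain u where "u \<in> Hom K Z W \<and> (\<forall>l \<in> J. u \<cdot> \<iota> l = (if l = j then g else h))"
      by (rule ex1E)
    then have u: "u \<cdot> \<iota> l = (if l = j then g else h)" if "l \<in> J" for l
      using that by simp
    show ?thesis using u[OF jk(1)] u[OF jk(2)] jk(3,4) by simp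
  qed
  have "is_coproduct K {\<iota> j} (\<lambda>_. Q) (\<lambda>m. m) Z"
    unfolding is_coproduct_def
  proof (intro conjI ballI allI impI)
    show "Z \<in> Ob K" using Z by (simp add: is_coproduct_def)
    show "m \<in> Hom K Q Z" if "m \<in> {\<iota> j}" for m
      using Z that jk by (auto simp: is_coproduct_def)
    fix W f assume W: "W \<in> Ob K" and f: "\<forall>m \<in> {\<iota> j}. f m \<in> Hom K Q W"
    have \<iota>: "\<iota> l \<in> Hom K Q Z" if "l \<in> J" for l
      using Z that by (simp add: is_coproduct_def)
    have all: "h \<cdot> \<iota> l = f (\<iota> j)" if "h \<in> Hom K Z W" "l \<in> J" for h l
      using single[OF W Comp_Hom[OF \<iota>[OF that(2)] that(1)]] f by simp
    have "\<exists>!h. h \<in> Hom K Z W \<and> (\<forall>l \<in> J. h \<cdot> \<iota> l = f (\<iota> j))"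
      using f by (intro coproduct_universal[OF Z W]) simp
    moreover have "(\<forall>l \<in> J. h \<cdot> \<iota> l = f (\<iota> j)) \<longleftrightarrow> (\<forall>m \<in> {\<iota> j}. h \<cdot> m = f m)"
      if "h \<in> Hom K Z W" for h
      using all[OF that] jk(1) by simp
    ultimately show "\<exists>!h. h \<in> Hom K Z W \<and> (\<forall>m \<in> {\<iota> j}. h \<cdot> m = f m)"
      by (simp cong: conj_cong)
  qed
  then show ?thesis by (rule that)
qed

lemma (in category) AddI:
  fixes J :: "'i set"
  assumes "X \<in> Ob K" "is_coproduct K J (\<lambda>_. Q) \<iota> Z" "is_direct_summand K X Z"
  shows "X \<in> Add K Q"
proof -
  obtain S :: "'m set" and \<iota>' where "is_coproduct K S (\<lambda>_. Q) \<iota>' Z"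
    using assms(2) by (rule coproduct_copies_reindex)
  then show ?thesis using assms(1,3) unfolding Add_def by blast
qed


section \<open>Abelian categories\<close>

record ('o, 'm) preadditive_category = "('o, 'm) category" +
  Plus :: "'m \<Rightarrow> 'm \<Rightarrow> 'm"
  Zero :: "'o \<Rightarrow> 'o \<Rightarrow> 'm"

text \<open>
  The library's finite sums over a bare commutative group are its finite products, with the group
  written multiplicatively.
\<close>

definition hom_group :: "('o, 'm, 'x) preadditive_category_scheme \<Rightarrow> 'o \<Rightarrow> 'o \<Rightarrow> 'm monoid" where
  "hom_group A X Y = \<lparr>carrier = Hom A X Y, mult = Plus A, one = Zero A X Y\<rparr>"

definition hom_sum ::
    "('o, 'm, 'x) preadditive_category_scheme \<Rightarrow> 'o \<Rightarrow> 'o \<Rightarrow> ('i \<Rightarrow> 'm) \<Rightarrow> 'i set \<Rightarrow> 'm" where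
  "hom_sum A X Y f J = finprod (hom_group A X Y) f J"

locale preadditive_category = category A
  for A :: "('o, 'm, 'x) preadditive_category_scheme" (structure) +
  assumes hom_comm_group: "\<lbrakk>X \<in> Ob A; Y \<in> Ob A\<rbrakk> \<Longrightarrow> comm_group (hom_group A X Y)"
    and Comp_Plus_right: "\<lbrakk>f \<in> Hom A X Y; f' \<in> Hom A X Y; g \<in> Hom A Y Z\<rbrakk>
          \<Longrightarrow> g \<cdot> Plus A f f' = Plus A (g \<cdot> f) (g \<cdot> f')"
    and Comp_Plus_left: "\<lbrakk>f \<in> Hom A X Y; g \<in> Hom A Y Z; g' \<in> Hom A Y Z\<rbrakk>
          \<Longrightarrow> Plus A g g' \<cdot> f = Plus A (g \<cdot> f) (g' \<cdot> f)"

definition is_kernel :: "('o, 'm, 'x) preadditive_category_scheme \<Rightarrow> 'm \<Rightarrow> 'm \<Rightarrow> bool" where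
  "is_kernel A f k \<longleftrightarrow> f \<in> Ar A \<and> k \<in> Ar A \<and> Target A k = Source A f \<and>
     f \<cdot>\<^bsub>A\<^esub> k = Zero A (Source A k) (Target A f) \<and>
     (\<forall>W \<in> Ob A. \<forall>h \<in> Hom A W (Source A f). f \<cdot>\<^bsub>A\<^esub> h = Zero A W (Target A f) \<longrightarrow>
        (\<exists>!u. u \<in> Hom A W (Source A k) \<and> k \<cdot>\<^bsub>A\<^esub> u = h))"

definition is_cokernel :: "('o, 'm, 'x) preadditive_category_scheme \<Rightarrow> 'm \<Rightarrow> 'm \<Rightarrow> bool" where
  "is_cokernel A f q \<longleftrightarrow> f \<in> Ar A \<and> q \<in> Ar A \<and> Source A q = Target A f \<and>
     q \<cdot>\<^bsub>A\<^esub> f = Zero A (Source A f) (Target A q) \<and>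
     (\<forall>W \<in> Ob A. \<forall>h \<in> Hom A (Target A f) W. h \<cdot>\<^bsub>A\<^esub> f = Zero A (Source A f) W \<longrightarrow>
        (\<exists>!u. u \<in> Hom A (Target A q) W \<and> u \<cdot>\<^bsub>A\<^esub> q = h))"

definition is_biproduct ::
    "('o, 'm, 'x) preadditive_category_scheme \<Rightarrow> 'i set \<Rightarrow> ('i \<Rightarrow> 'o) \<Rightarrow>
       'o \<times> ('i \<Rightarrow> 'm) \<times> ('i \<Rightarrow> 'm) \<Rightarrow> bool" where
  "is_biproduct A J X = (\<lambda>(Z, \<iota>, \<pi>). Z \<in> Ob A \<and>
     (\<forall>j \<in> J. \<iota> j \<in> Hom A (X j) Z \<and> \<pi> j \<in> Hom A Z (X j)) \<and>
     (\<forall>j \<in> J. \<forall>k \<in> J. \<pi> k \<cdot>\<^bsub>A\<^esub> \<iota> j = (if j = k then Ide A (X j) else Zero A (X j) (X k))) \<and>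
     hom_sum A Z Z (\<lambda>j. \<iota> j \<cdot>\<^bsub>A\<^esub> \<pi> j) J = Ide A Z)"

locale abelian_category = preadditive_category A
  for A :: "('o, 'm, 'x) preadditive_category_scheme" (structure) +
  assumes finite_biproducts: "\<lbrakk>finite (J :: nat set); \<And>j. j \<in> J \<Longrightarrow> X j \<in> Ob A\<rbrakk>
          \<Longrightarrow> \<exists>B. is_biproduct A J X B"
    and has_kernel: "f \<in> Ar A \<Longrightarrow> \<exists>k. is_kernel A f k"
    and has_cokernel: "f \<in> Ar A \<Longrightarrow> \<exists>q. is_cokernel A f q"
    and mono_normal: "is_mono A k \<Longrightarrow> \<exists>f. is_kernel A f k"
    and epi_normal: "is_epi A q \<Longrightarrow> \<exists>f. is_cokernel A f q"

text \<open>A choice of the direct sum of a finite family, with its injections and projections.\<close>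

definition dsum ::
    "('o, 'm, 'x) preadditive_category_scheme \<Rightarrow> 'i set \<Rightarrow> ('i \<Rightarrow> 'o) \<Rightarrow>
       'o \<times> ('i \<Rightarrow> 'm) \<times> ('i \<Rightarrow> 'm)" where
  "dsum A J X = (SOME B. is_biproduct A J X B)"

definition dsum_ob :: "('o, 'm, 'x) preadditive_category_scheme \<Rightarrow> 'i set \<Rightarrow> ('i \<Rightarrow> 'o) \<Rightarrow> 'o" where
  "dsum_ob A J X = fst (dsum A J X)"

definition dsum_inj ::
    "('o, 'm, 'x) preadditive_category_scheme \<Rightarrow> 'i set \<Rightarrow> ('i \<Rightarrow> 'o) \<Rightarrow> 'i \<Rightarrow> 'm" where
  "dsum_inj A J X = fst (snd (dsum A J X))"

definition dsum_proj ::
    "('o, 'm, 'x) preadditive_category_scheme \<Rightarrow> 'i set \<Rightarrow> ('i \<Rightarrow> 'o) \<Rightarrow> 'i \<Rightarrow> 'm" where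
  "dsum_proj A J X = snd (snd (dsum A J X))"

definition coker_ob :: "('o, 'm, 'x) preadditive_category_scheme \<Rightarrow> 'm \<Rightarrow> 'o" where
  "coker_ob A f = Target A (SOME q. is_cokernel A f q)"


section \<open>Endofunctors\<close>

record ('o, 'm) endofunctor =
  on_ob :: "'o \<Rightarrow> 'o"
  on_ar :: "'m \<Rightarrow> 'm"

locale endofunctor = category A
  for A :: "('o, 'm, 'x) category_scheme" (structure)
    and F :: "('o, 'm) endofunctor" +
  assumes on_ob_Ob: "X \<in> Ob A \<Longrightarrow> on_ob F X \<in> Ob A"
    and on_ar_Hom: "f \<in> Hom A X Y \<Longrightarrow> on_ar F f \<in> Hom A (on_ob F X) (on_ob F Y)"
    and on_ar_Ide: "X \<in> Ob A \<Longrightarrow> on_ar F (Ide A X) = Ide A (on_ob F X)"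
    and on_ar_Comp: "\<lbrakk>f \<in> Hom A X Y; g \<in> Hom A Y Z\<rbrakk>
          \<Longrightarrow> on_ar F (g \<cdot> f) = on_ar F g \<cdot> on_ar F f"

definition functor_comp ::
    "('o, 'm) endofunctor \<Rightarrow> ('o, 'm) endofunctor \<Rightarrow> ('o, 'm) endofunctor" where
  "functor_comp F G = \<lparr>on_ob = on_ob F \<circ> on_ob G, on_ar = on_ar F \<circ> on_ar G\<rparr>"

definition additive_functor ::
    "('o, 'm, 'x) preadditive_category_scheme \<Rightarrow> ('o, 'm) endofunctor \<Rightarrow> bool" where
  "additive_functor A F \<longleftrightarrow>
     (\<forall>X \<in> Ob A. \<forall>Y \<in> Ob A. \<forall>f \<in> Hom A X Y. \<forall>g \<in> Hom A X Y.
        on_ar F (Plus A f g) = Plus A (on_ar F f) (on_ar F g))"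

text \<open>
  A sequence \<open>X \<rightarrow> Y \<rightarrow> Q \<rightarrow> 0\<close> is exact iff its second arrow is a cokernel of its first.
\<close>

definition right_exact ::
    "('o, 'm, 'x) preadditive_category_scheme \<Rightarrow> ('o, 'm) endofunctor \<Rightarrow> bool" where
  "right_exact A F \<longleftrightarrow> (\<forall>f q. is_cokernel A f q \<longrightarrow> is_cokernel A (on_ar F f) (on_ar F q))"

definition right_adjoint_to ::
    "('o, 'm, 'x) category_scheme \<Rightarrow> ('o, 'm) endofunctor \<Rightarrow> ('o, 'm) endofunctor \<Rightarrow> bool" where
  "right_adjoint_to A F G \<longleftrightarrow> endofunctor A G \<and>
     (\<exists>\<phi>.
        (\<forall>X \<in> Ob A. \<forall>Y \<in> Ob A. bij_betw (\<phi> X Y) (Hom A (on_ob F X) Y) (Hom A X (on_ob G Y))) \<and>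
        (\<forall>X \<in> Ob A. \<forall>X' \<in> Ob A. \<forall>Y \<in> Ob A. \<forall>Y' \<in> Ob A.
         \<forall>u \<in> Hom A X' X. \<forall>v \<in> Hom A Y Y'. \<forall>h \<in> Hom A (on_ob F X) Y.
           \<phi> X' Y' (v \<cdot>\<^bsub>A\<^esub> h \<cdot>\<^bsub>A\<^esub> on_ar F u) = on_ar G v \<cdot>\<^bsub>A\<^esub> \<phi> X Y h \<cdot>\<^bsub>A\<^esub> u))"

definition natural_transformation ::
    "('o, 'm, 'x) category_scheme \<Rightarrow> ('o, 'm) endofunctor \<Rightarrow> ('o, 'm) endofunctor \<Rightarrow>
       ('o \<Rightarrow> 'm) \<Rightarrow> bool" where
  "natural_transformation A F G \<tau> \<longleftrightarrow>
     (\<forall>X \<in> Ob A. \<tau> X \<in> Hom A (on_ob F X) (on_ob G X)) \<and>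
     (\<forall>X \<in> Ob A. \<forall>Y \<in> Ob A. \<forall>h \<in> Hom A X Y. \<tau> Y \<cdot>\<^bsub>A\<^esub> on_ar F h = on_ar G h \<cdot>\<^bsub>A\<^esub> \<tau> X)"


section \<open>The right n-trivial extension\<close>

definition associative_family ::
    "('o, 'm, 'x) category_scheme \<Rightarrow> nat \<Rightarrow> (nat \<Rightarrow> ('o, 'm) endofunctor) \<Rightarrow>
       (nat \<Rightarrow> nat \<Rightarrow> 'o \<Rightarrow> 'm) \<Rightarrow> bool" where
  "associative_family A n F \<Phi> \<longleftrightarrow>
     (\<forall>X \<in> Ob A. \<forall>i \<in> {1..n}. \<forall>j \<in> {1..n}. \<forall>k \<in> {1..n}. i + j + k \<in> {1..n} \<longrightarrow>
        \<Phi> i (j + k) X \<cdot>\<^bsub>A\<^esub> on_ar (F i) (\<Phi> j k X)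
          = \<Phi> (i + j) k X \<cdot>\<^bsub>A\<^esub> \<Phi> i j (on_ob (F k) X))"

text \<open>
  The structure maps form an extensional family on \<open>{1..n}\<close>, so that there are no spurious objects
  differing only outside the index set. An arrow \<open>\<gamma>\<close> is tagged with its source and target, as the same
  \<open>\<gamma>\<close> may be a morphism between several pairs of objects.
\<close>

definition ext_obs ::
    "('o, 'm, 'x) preadditive_category_scheme \<Rightarrow> nat \<Rightarrow> (nat \<Rightarrow> ('o, 'm) endofunctor) \<Rightarrow>
       (nat \<Rightarrow> nat \<Rightarrow> 'o \<Rightarrow> 'm) \<Rightarrow> ('o \<times> (nat \<Rightarrow> 'm)) set" where
  "ext_obs A n F \<Phi> = {(X, f). X \<in> Ob A \<and> f \<in> (\<Pi>\<^sub>E i \<in> {1..n}. Hom A (on_ob (F i) X) X) \<and>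
     (\<forall>i \<in> {1..n}. \<forall>j \<in> {1..n}.
        f i \<cdot>\<^bsub>A\<^esub> on_ar (F i) (f j) =
          (if i + j \<le> n then f (i + j) \<cdot>\<^bsub>A\<^esub> \<Phi> i j X
           else Zero A (on_ob (F i) (on_ob (F j) X)) X))}"

definition ext_hom ::
    "('o, 'm, 'x) preadditive_category_scheme \<Rightarrow> nat \<Rightarrow> (nat \<Rightarrow> ('o, 'm) endofunctor) \<Rightarrow>
       'o \<times> (nat \<Rightarrow> 'm) \<Rightarrow> 'o \<times> (nat \<Rightarrow> 'm) \<Rightarrow> 'm set" where
  "ext_hom A n F = (\<lambda>(X, \<alpha>) (Y, \<beta>).
     {\<gamma> \<in> Hom A X Y. \<forall>i \<in> {1..n}. \<gamma> \<cdot>\<^bsub>A\<^esub> \<alpha> i = \<beta> i \<cdot>\<^bsub>A\<^esub> on_ar (F i) \<gamma>})"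

type_synonym ('o, 'm) ext_ob = "'o \<times> (nat \<Rightarrow> 'm)"
type_synonym ('o, 'm) ext_ar = "('o, 'm) ext_ob \<times> ('o, 'm) ext_ob \<times> 'm"

definition trivial_extension ::
    "('o, 'm, 'x) preadditive_category_scheme \<Rightarrow> nat \<Rightarrow> (nat \<Rightarrow> ('o, 'm) endofunctor) \<Rightarrow>
       (nat \<Rightarrow> nat \<Rightarrow> 'o \<Rightarrow> 'm) \<Rightarrow> (('o, 'm) ext_ob, ('o, 'm) ext_ar) category" where
  "trivial_extension A n F \<Phi> =
     \<lparr>Ob = ext_obs A n F \<Phi>,
      Ar = {(x, y, \<gamma>). x \<in> ext_obs A n F \<Phi> \<and> y \<in> ext_obs A n F \<Phi> \<and> \<gamma> \<in> ext_hom A n F x y},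
      Source = (\<lambda>(x, y, \<gamma>). x),
      Target = (\<lambda>(x, y, \<gamma>). y),
      Ide = (\<lambda>x. (x, x, Ide A (fst x))),
      Comp = (\<lambda>(y, z, \<delta>) (x, y', \<gamma>). (x, z, \<delta> \<cdot>\<^bsub>A\<^esub> \<gamma>))\<rparr>"

text \<open>The summands of the underlying object of \<open>T(X)\<close>: index 0 stands for \<open>X\<close> itself.\<close>

definition T_summand :: "(nat \<Rightarrow> ('o, 'm) endofunctor) \<Rightarrow> 'o \<Rightarrow> nat \<Rightarrow> 'o" where
  "T_summand F X j = (if j = 0 then X else on_ob (F j) X)"

text \<open>
  \<open>\<kappa>\<^sub>i\<close> as a matrix: since \<open>F\<^sub>i\<close> is additive, the arrows \<open>F\<^sub>i(\<pi>\<^sub>j)\<close> are the projections of \<open>F\<^sub>i(T X)\<close>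
  onto \<open>F\<^sub>i X\<close> (for \<open>j = 0\<close>) and \<open>F\<^sub>i F\<^sub>j X\<close> (for \<open>j \<ge> 1\<close>), and the only nonzero components are those from
  the \<open>j\<close>-th to the \<open>(i+j)\<close>-th summand for \<open>i + j \<le> n\<close>.
\<close>

definition T_map ::
    "('o, 'm, 'x) preadditive_category_scheme \<Rightarrow> nat \<Rightarrow> (nat \<Rightarrow> ('o, 'm) endofunctor) \<Rightarrow>
       (nat \<Rightarrow> nat \<Rightarrow> 'o \<Rightarrow> 'm) \<Rightarrow> 'o \<Rightarrow> nat \<Rightarrow> 'm" where
  "T_map A n F \<Phi> X i =
     (let Z = dsum_ob A {0..n} (T_summand F X);
          \<iota> = dsum_inj A {0..n} (T_summand F X);
          \<pi> = dsum_proj A {0..n} (T_summand F X)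
      in hom_sum A (on_ob (F i) Z) Z
           (\<lambda>j. \<iota> (i + j) \<cdot>\<^bsub>A\<^esub>
                (if j = 0 then Ide A (on_ob (F i) X) else \<Phi> i j X) \<cdot>\<^bsub>A\<^esub> on_ar (F i) (\<pi> j))
           {j. i + j \<le> n})"

definition T_ob ::
    "('o, 'm, 'x) preadditive_category_scheme \<Rightarrow> nat \<Rightarrow> (nat \<Rightarrow> ('o, 'm) endofunctor) \<Rightarrow>
       (nat \<Rightarrow> nat \<Rightarrow> 'o \<Rightarrow> 'm) \<Rightarrow> 'o \<Rightarrow> ('o, 'm) ext_ob" where
  "T_ob A n F \<Phi> X = (dsum_ob A {0..n} (T_summand F X), (\<lambda>i \<in> {1..n}. T_map A n F \<Phi> X i))"

text \<open>The arrow \<open>(f\<^sub>i)\<^sub>i\<close> from the direct sum of the \<open>F\<^sub>i X\<close> to \<open>X\<close> is \<open>\<Sum>\<^sub>i f\<^sub>i \<pi>\<^sub>i\<close>.\<close>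

definition C_ob ::
    "('o, 'm, 'x) preadditive_category_scheme \<Rightarrow> nat \<Rightarrow> (nat \<Rightarrow> ('o, 'm) endofunctor) \<Rightarrow>
       ('o, 'm) ext_ob \<Rightarrow> 'o" where
  "C_ob A n F = (\<lambda>(X, f).
     coker_ob A
       (hom_sum A (dsum_ob A {1..n} (\<lambda>i. on_ob (F i) X)) X
          (\<lambda>i. f i \<cdot>\<^bsub>A\<^esub> dsum_proj A {1..n} (\<lambda>i. on_ob (F i) X) i) {1..n}))"

end

(*
  T is left adjoint to the forgetful functor (X,f) |-> X, and C is left adjoint to D |-> (D,0), so
  both preserve coproducts, and CT = id; this gives C(X,f) in Add(P) one way and (X,f) in Add(T(P))
  the other. There remains: a retract (X,f) of T(Z) is isomorphic to T(B), where B = C(X,f).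
  Since B is then a retract of Z, the projection X -> B splits, which gives theta: T(B) -> (X,f),
  and the retraction gives psi: (X,f) -> T(B), both inducing the identity on B under C. An
  endomorphism u of a retract of T(Z) with C(u) = id is invertible: 1 - u induces an endomorphism
  of T(Z) that strictly raises the filtration by degree, so 1 - u is nilpotent. Hence theta psi and
  psi theta are invertible.
*)
theory Submission
  imports Defs
begin

section \<open>Categories and preadditive categories\<close>

text \<open>Infinite coproducts are not assumed to exist in \<open>A\<close>, so a coproduct
  \<open>w\<close> of copies of T(P) in the extension does not come in the form T(Z). C supplies the
  missing object: Z = C(w) is a coproduct of copies of P, hence T(Z) is a coproduct of the same
  family as \<open>w\<close> and isomorphic to it. Both adjunctions are used objectwise, as
  universal arrows (\<open>free_ext\<close>, \<open>cokernel_ext\<close>). These fix objects only up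
  to isomorphism, so the choices of biproducts and cokernels inside \<open>T_ob\<close> and
  \<open>C_ob\<close> never have to be compared, and neither T nor C has to be defined on arrows.
  The filtration argument rests on two facts about T(Z): its j-th summand is generated by Z through
  the j-th structure map, and that map raises degrees by at least j. An endomorphism of T(Z) with
  image in positive degrees therefore sends degree j into degrees above j. There are n + 1 degrees,
  so its (n + 1)-st power vanishes. For a retract, the powers are computed in T(Z) and pulled back
  along the retraction.\<close>

lemma Hom_iff: "f \<in> Hom K X Y \<longleftrightarrow> f \<in> Ar K \<and> Source K f = X \<and> Target K f = Y"
  by (simp add: Hom_def)

context category
begin

text \<open>Phrased with \<open>Source\<close> and \<open>Target\<close> instead of
  \<open>Hom\<close>, these rules leave no intermediate object for the simplifier to guess;
  \<open>Hom_iff\<close> converts to this form.\<close>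

lemma Comp_Ar [simp]:
  assumes "f \<in> Ar K" "g \<in> Ar K" "Source K g = Target K f"
  shows "g \<cdot> f \<in> Ar K" "Source K (g \<cdot> f) = Source K f" "Target K (g \<cdot> f) = Target K g"
  using Comp_Hom[of f "Source K f" "Target K f" g "Target K g"] assms by (simp_all add: Hom_iff)

lemma Comp_assoc_Ar [simp]:
  assumes "f \<in> Ar K" "g \<in> Ar K" "h \<in> Ar K" "Source K g = Target K f" "Source K h = Target K g"
  shows "(h \<cdot> g) \<cdot> f = h \<cdot> g \<cdot> f"
  using Comp_assoc[of f "Source K f" "Target K f" g "Target K g" h "Target K h"] assms
  by (simp add: Hom_iff)

lemma Ide_Ar [simp]:
  assumes "X \<in> Ob K"
  shows "Ide K X \<in> Ar K" "Source K (Ide K X) = X" "Target K (Ide K X) = X"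
  using Ide_Hom[OF assms] by (simp_all add: Hom_iff)

lemma Ide_Comp [simp]: "\<lbrakk>f \<in> Ar K; Target K f = X\<rbrakk> \<Longrightarrow> Ide K X \<cdot> f = f"
  using Ide_left[of f "Source K f" X] by (simp add: Hom_iff)

lemma Comp_Ide [simp]: "\<lbrakk>f \<in> Ar K; Source K f = X\<rbrakk> \<Longrightarrow> f \<cdot> Ide K X = f"
  using Ide_right[of f X "Target K f"] by (simp add: Hom_iff)

lemma Hom_Ob: "f \<in> Hom K X Y \<Longrightarrow> X \<in> Ob K" "f \<in> Hom K X Y \<Longrightarrow> Y \<in> Ob K"
  using Source_Ob Target_Ob by (auto simp: Hom_iff)

lemma two_sided_inverse:
  assumes "t \<in> Hom K X Y" "l \<in> Hom K Y X" "r \<in> Hom K Y X"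
    and "l \<cdot> t = Ide K X" "t \<cdot> r = Ide K Y"
  shows "l = r"
proof -
  have "l = l \<cdot> t \<cdot> r" using assms by (simp add: Hom_iff)
  also have "\<dots> = (l \<cdot> t) \<cdot> r" using assms(1-3) by (simp add: Hom_iff)
  also have "\<dots> = r" using assms Hom_Ob[OF assms(1)] by (simp add: Hom_iff)
  finally show ?thesis .
qed

end

section \<open>Hom-groups, zero arrows and the inverse of 1 - M\<close>

context preadditive_category
begin

lemma hom_group_simps [simp]:
  "carrier (hom_group A X Y) = Hom A X Y" "mult (hom_group A X Y) = Plus A"
  "one (hom_group A X Y) = Zero A X Y"
  by (simp_all add: hom_group_def)

lemma Zero_Hom: "\<lbrakk>X \<in> Ob A; Y \<in> Ob A\<rbrakk> \<Longrightarrow> Zero A X Y \<in> Hom A X Y"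
  using group.is_monoid[OF comm_group.axioms(2)[OF hom_comm_group], THEN monoid.one_closed] by simp

lemma Zero_Ar [simp]:
  assumes "X \<in> Ob A" "Y \<in> Ob A"
  shows "Zero A X Y \<in> Ar A" "Source A (Zero A X Y) = X" "Target A (Zero A X Y) = Y"
  using Zero_Hom[OF assms] by (simp_all add: Hom_iff)

lemma Plus_Hom:
  assumes "f \<in> Hom A X Y" "g \<in> Hom A X Y"
  shows "Plus A f g \<in> Hom A X Y"
proof -
  interpret comm_group "hom_group A X Y" using assms Hom_Ob by (blast intro: hom_comm_group)
  show ?thesis using m_closed assms by simp
qed

lemma Plus_assoc:
  assumes "f \<in> Hom A X Y" "g \<in> Hom A X Y" "h \<in> Hom A X Y"
  shows "Plus A (Plus A f g) h = Plus A f (Plus A g h)"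
proof -
  interpret comm_group "hom_group A X Y" using assms Hom_Ob by (blast intro: hom_comm_group)
  show ?thesis using m_assoc assms by simp
qed

lemma Plus_commute:
  assumes "f \<in> Hom A X Y" "g \<in> Hom A X Y"
  shows "Plus A f g = Plus A g f"
proof -
  interpret comm_group "hom_group A X Y" using assms Hom_Ob by (blast intro: hom_comm_group)
  show ?thesis using m_comm assms by simp
qed

lemma Plus_cancel:
  assumes "f \<in> Hom A X Y" "g \<in> Hom A X Y" "h \<in> Hom A X Y"
  shows "Plus A f g = Plus A f h \<longleftrightarrow> g = h"
proof -
  interpret comm_group "hom_group A X Y" using assms Hom_Ob by (blast intro: hom_comm_group)
  show ?thesis using Units_l_cancel[of f g h] Units_eq assms by simp
qed

lemma Plus_Zero:
  assumes "f \<in> Hom A X Y"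
  shows "Plus A f (Zero A X Y) = f" "Plus A (Zero A X Y) f = f"
proof -
  interpret comm_group "hom_group A X Y" using assms Hom_Ob by (blast intro: hom_comm_group)
  show "Plus A f (Zero A X Y) = f" "Plus A (Zero A X Y) f = f" using r_one l_one assms by simp_all
qed

text \<open>The record of a preadditive category carries no negation. This supplies the difference
  \<open>g - f\<close> through the group inverse; later arguments write \<open>M = 1 - u\<close> as
  \<open>Plus A u M = Ide A X\<close>.\<close>

lemma Plus_complement:
  assumes "f \<in> Hom A X Y" "g \<in> Hom A X Y"
  obtains h where "h \<in> Hom A X Y" "Plus A f h = g"
proof -
  interpret comm_group "hom_group A X Y" using assms Hom_Ob by (blast intro: hom_comm_group)
  have f: "f \<in> carrier (hom_group A X Y)" and g: "g \<in> carrier (hom_group A X Y)"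
    using assms by simp_all
  have "inv\<^bsub>hom_group A X Y\<^esub> f \<otimes>\<^bsub>hom_group A X Y\<^esub> g \<in> carrier (hom_group A X Y)"
    using f g by (intro m_closed inv_closed)
  moreover have "f \<otimes>\<^bsub>hom_group A X Y\<^esub> (inv\<^bsub>hom_group A X Y\<^esub> f \<otimes>\<^bsub>hom_group A X Y\<^esub> g) = g"
    using f g m_assoc[OF f inv_closed[OF f] g] r_inv[OF f] l_one[OF g] by metis
  ultimately show ?thesis using that by simp
qed

lemma Comp_Zero [simp]:
  assumes "g \<in> Ar A" "Source A g = Y" "X \<in> Ob A"
  shows "g \<cdot> Zero A X Y = Zero A X (Target A g)"
proof -
  have Y: "Y \<in> Ob A" "Target A g \<in> Ob A" using assms Source_Ob Target_Ob by auto
  note Z = Zero_Hom[OF assms(3) Y(1)]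
  have g: "g \<in> Hom A Y (Target A g)" using assms by (simp add: Hom_iff)
  have gZ: "g \<cdot> Zero A X Y \<in> Hom A X (Target A g)" using Comp_Hom[OF Z g] .
  have "Plus A (g \<cdot> Zero A X Y) (g \<cdot> Zero A X Y) = Plus A (g \<cdot> Zero A X Y) (Zero A X (Target A g))"
    using Comp_Plus_right[OF Z Z g] Plus_Zero(1)[OF Z] Plus_Zero(1)[OF gZ] by simp
  then show ?thesis using Plus_cancel[OF gZ gZ Zero_Hom[OF assms(3) Y(2)]] by simp
qed

lemma Zero_Comp [simp]:
  assumes "f \<in> Ar A" "Target A f = Y" "Z \<in> Ob A"
  shows "Zero A Y Z \<cdot> f = Zero A (Source A f) Z"
proof -
  have Y: "Y \<in> Ob A" "Source A f \<in> Ob A" using assms Source_Ob Target_Ob by auto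
  note Z = Zero_Hom[OF Y(1) assms(3)]
  have f: "f \<in> Hom A (Source A f) Y" using assms by (simp add: Hom_iff)
  have Zf: "Zero A Y Z \<cdot> f \<in> Hom A (Source A f) Z" using Comp_Hom[OF f Z] .
  have "Plus A (Zero A Y Z \<cdot> f) (Zero A Y Z \<cdot> f) = Plus A (Zero A Y Z \<cdot> f) (Zero A (Source A f) Z)"
    using Comp_Plus_left[OF f Z Z] Plus_Zero(1)[OF Z] Plus_Zero(1)[OF Zf] by simp
  then show ?thesis using Plus_cancel[OF Zf Zf Zero_Hom[OF Y(2) assms(3)]] by simp
qed

text \<open>Since \<open>u\<close> is \<open>1 - M\<close>, the geometric series 1 + M + ... +
  M^(k-1) inverts it as soon as \<open>M^k = 0\<close>. The induction carries the partial sum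
  \<open>v\<close> with \<open>v \<cdot> u + M^k = 1\<close> and
  \<open>u \<cdot> v + M^k = 1\<close> at once.\<close>

lemma one_minus_nilpotent_inverse:
  assumes u: "u \<in> Hom A X X" and M: "M \<in> Hom A X X" and uM: "Plus A u M = Ide A X"
    and nil: "((\<cdot>) M ^^ k) (Ide A X) = Zero A X X"
  obtains v where "v \<in> Hom A X X" "v \<cdot> u = Ide A X" "u \<cdot> v = Ide A X"
proof -
  have X: "X \<in> Ob A" using Hom_Ob u by blast
  have pow: "((\<cdot>) M ^^ k) (Ide A X) \<in> Hom A X X" for k
    by (induction k) (use M X in \<open>auto simp: Hom_iff\<close>)
  have MM: "M \<cdot> M \<in> Hom A X X" and uM': "u \<cdot> M \<in> Hom A X X" and Mu: "M \<cdot> u \<in> Hom A X X"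
    using u M by (auto simp: Hom_iff)
  \<comment> \<open>Both sides equal \<open>M\<close>, because \<open>u + M = 1\<close>; cancelling
    \<open>M \<cdot> M\<close> shows that \<open>u\<close> and \<open>M\<close> commute.\<close>
  have "Plus A (u \<cdot> M) (M \<cdot> M) = Plus A (M \<cdot> u) (M \<cdot> M)"
    using Comp_Plus_left[OF M u M] Comp_Plus_right[OF u M M] uM M by (simp add: Hom_iff)
  then have comm: "u \<cdot> M = M \<cdot> u"
    using Plus_cancel[OF MM uM' Mu] Plus_commute MM uM' Mu by metis
  have "\<exists>v \<in> Hom A X X. Plus A (v \<cdot> u) (((\<cdot>) M ^^ k) (Ide A X)) = Ide A X \<and>
      Plus A (u \<cdot> v) (((\<cdot>) M ^^ k) (Ide A X)) = Ide A X" for k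
  proof (induction k)
    case 0
    show ?case
      using u X Plus_Zero[OF Ide_Hom[OF X]] Zero_Hom[OF X X]
        by (intro bexI[of _ "Zero A X X"]) (simp_all add: Hom_iff)
  next
    case (Suc k)
    define p where "p = ((\<cdot>) M ^^ k) (Ide A X)"
    have p: "p \<in> Hom A X X" using pow by (simp add: p_def)
    obtain v where v: "v \<in> Hom A X X" "Plus A (v \<cdot> u) p = Ide A X" "Plus A (u \<cdot> v) p = Ide A X"
      using Suc p_def by auto
    have H: "M \<cdot> v \<in> Hom A X X" "M \<cdot> p \<in> Hom A X X" "v \<cdot> u \<in> Hom A X X" "u \<cdot> v \<in> Hom A X X"
      "M \<cdot> v \<cdot> u \<in> Hom A X X" "M \<cdot> u \<cdot> v \<in> Hom A X X"
      using M p u v by (auto simp: Hom_iff)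
    \<comment> \<open>Horner step: if \<open>v\<close> is the sum of the first k powers of
      \<open>M\<close>, starting with the identity, then \<open>1 + M \<cdot> v\<close> is the sum
      of the first k + 1.\<close>
    let ?w = "Plus A (Ide A X) (M \<cdot> v)"
    have w: "?w \<in> Hom A X X" using Plus_Hom[OF Ide_Hom[OF X] H(1)] .
    have "?w \<cdot> u = Plus A u (M \<cdot> v \<cdot> u)"
      using Comp_Plus_left[OF u Ide_Hom[OF X] H(1)] M u v by (simp add: Hom_iff)
    then have "Plus A (?w \<cdot> u) (M \<cdot> p) = Plus A u (Plus A (M \<cdot> v \<cdot> u) (M \<cdot> p))"
      using Plus_assoc[OF u H(5) H(2)] by simp
    also have "\<dots> = Plus A u (M \<cdot> Plus A (v \<cdot> u) p)"
      using Comp_Plus_right[OF H(3) p M] by simp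
    also have "\<dots> = Ide A X" using v uM M by (simp add: Hom_iff)
    finally have 1: "Plus A (?w \<cdot> u) (M \<cdot> p) = Ide A X" .
    have "u \<cdot> M \<cdot> v = M \<cdot> u \<cdot> v"
      using comm u v M Comp_assoc[OF v(1) M u] by (simp add: Hom_iff)
    then have "u \<cdot> ?w = Plus A u (M \<cdot> u \<cdot> v)"
      using Comp_Plus_right[OF Ide_Hom[OF X] H(1) u] u by (simp add: Hom_iff)
    then have "Plus A (u \<cdot> ?w) (M \<cdot> p) = Plus A u (Plus A (M \<cdot> u \<cdot> v) (M \<cdot> p))"
      using Plus_assoc[OF u H(6) H(2)] by simp
    also have "\<dots> = Plus A u (M \<cdot> Plus A (u \<cdot> v) p)"
      using Comp_Plus_right[OF H(4) p M] by simp
    also have "\<dots> = Ide A X" using v uM M by (simp add: Hom_iff)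
    finally show ?case using 1 w by (auto simp: p_def[symmetric])
  qed
  from this[of k] obtain v where v: "v \<in> Hom A X X"
    "Plus A (v \<cdot> u) (Zero A X X) = Ide A X" "Plus A (u \<cdot> v) (Zero A X X) = Ide A X"
    using nil by auto
  then show ?thesis
    using that Plus_Zero(1)[OF Comp_Hom[OF u v(1)]] Plus_Zero(1)[OF Comp_Hom[OF v(1) u]] by simp
qed

section \<open>Finite sums of arrows and decompositions of the identity\<close>

lemma hom_sum_empty:
  assumes "X \<in> Ob A" "Y \<in> Ob A"
  shows "hom_sum A X Y f {} = Zero A X Y"
proof -
  interpret comm_group "hom_group A X Y" using assms by (rule hom_comm_group)
  show ?thesis by (simp add: hom_sum_def)
qed

lemma hom_sum_insert:
  assumes "X \<in> Ob A" "Y \<in> Ob A" "finite J" "j \<notin> J" "\<And>k. k \<in> insert j J \<Longrightarrow> f k \<in> Hom A X Y"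
  shows "hom_sum A X Y f (insert j J) = Plus A (f j) (hom_sum A X Y f J)"
proof -
  interpret comm_group "hom_group A X Y" using assms by (blast intro: hom_comm_group)
  show ?thesis using assms by (simp add: hom_sum_def finprod_insert)
qed

lemma hom_sum_Hom:
  assumes "X \<in> Ob A" "Y \<in> Ob A" "\<And>k. k \<in> J \<Longrightarrow> f k \<in> Hom A X Y"
  shows "hom_sum A X Y f J \<in> Hom A X Y"
proof -
  interpret comm_group "hom_group A X Y" using assms by (blast intro: hom_comm_group)
  show ?thesis using assms finprod_closed[of f J] by (simp add: hom_sum_def Pi_def)
qed

lemma hom_sum_cong:
  assumes "X \<in> Ob A" "Y \<in> Ob A" "\<And>k. k \<in> J \<Longrightarrow> f k \<in> Hom A X Y" "\<And>k. k \<in> J \<Longrightarrow> f k = g k"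
  shows "hom_sum A X Y f J = hom_sum A X Y g J"
proof -
  interpret comm_group "hom_group A X Y" using assms by (blast intro: hom_comm_group)
  show ?thesis unfolding hom_sum_def using assms by (intro finprod_cong') (auto simp: Pi_def)
qed

lemma hom_sum_Zero:
  assumes "X \<in> Ob A" "Y \<in> Ob A" "\<And>k. k \<in> J \<Longrightarrow> f k = Zero A X Y"
  shows "hom_sum A X Y f J = Zero A X Y"
proof -
  interpret comm_group "hom_group A X Y" using assms by (blast intro: hom_comm_group)
  show ?thesis using finprod_one_eqI[of J f] assms by (simp add: hom_sum_def)
qed

lemma hom_sum_single:
  assumes "X \<in> Ob A" "Y \<in> Ob A" "finite J" "k \<in> J" "f k \<in> Hom A X Y"
    and "\<And>j. \<lbrakk>j \<in> J; j \<noteq> k\<rbrakk> \<Longrightarrow> f j = Zero A X Y"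
  shows "hom_sum A X Y f J = f k"
proof -
  have "hom_sum A X Y f (insert k (J - {k})) = Plus A (f k) (hom_sum A X Y f (J - {k}))"
  proof (intro hom_sum_insert)
    fix j assume "j \<in> insert k (J - {k})"
    then show "f j \<in> Hom A X Y" using assms Zero_Hom by (cases "j = k") auto
  qed (use assms in auto)
  then show ?thesis
    using assms hom_sum_Zero[of X Y "J - {k}" f] Plus_Zero by (simp add: insert_absorb)
qed

lemma Comp_hom_sum:
  assumes "X \<in> Ob A" "g \<in> Hom A Y Z" "finite J" "\<And>k. k \<in> J \<Longrightarrow> f k \<in> Hom A X Y"
  shows "g \<cdot> hom_sum A X Y f J = hom_sum A X Z (\<lambda>k. g \<cdot> f k) J"
  using assms(3,4)
proof (induction J)
  case empty
  show ?case using assms(1,2) Hom_Ob[OF assms(2)] by (auto simp: hom_sum_empty Hom_iff)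
next
  case (insert j J)
  note Y = Hom_Ob[OF assms(2)]
  have "g \<cdot> Plus A (f j) (hom_sum A X Y f J) = Plus A (g \<cdot> f j) (g \<cdot> hom_sum A X Y f J)"
    using insert.prems assms(1,2) Y
      by (intro Comp_Plus_right[where X = X and Y = Y and Z = Z] hom_sum_Hom) simp_all
  moreover have "hom_sum A X Y f (insert j J) = Plus A (f j) (hom_sum A X Y f J)"
    using insert assms(1,2) Y by (intro hom_sum_insert) simp_all
  moreover have "hom_sum A X Z (\<lambda>k. g \<cdot> f k) (insert j J)
      = Plus A (g \<cdot> f j) (hom_sum A X Z (\<lambda>k. g \<cdot> f k) J)"
    using insert.hyps insert.prems assms(1,2) Y
      by (intro hom_sum_insert Comp_Hom[where Y = Y]) simp_all
  ultimately show ?case using insert by simp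
qed

lemma hom_sum_Comp:
  assumes "Z \<in> Ob A" "g \<in> Hom A X Y" "finite J" "\<And>k. k \<in> J \<Longrightarrow> f k \<in> Hom A Y Z"
  shows "hom_sum A Y Z f J \<cdot> g = hom_sum A X Z (\<lambda>k. f k \<cdot> g) J"
  using assms(3,4)
proof (induction J)
  case empty
  show ?case using assms(1,2) Hom_Ob[OF assms(2)] by (auto simp: hom_sum_empty Hom_iff)
next
  case (insert j J)
  note Y = Hom_Ob[OF assms(2)]
  have "Plus A (f j) (hom_sum A Y Z f J) \<cdot> g = Plus A (f j \<cdot> g) (hom_sum A Y Z f J \<cdot> g)"
    using insert.prems assms(1,2) Y
      by (intro Comp_Plus_left[where X = X and Y = Y and Z = Z] hom_sum_Hom) simp_all
  moreover have "hom_sum A Y Z f (insert j J) = Plus A (f j) (hom_sum A Y Z f J)"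
    using insert assms(1,2) Y by (intro hom_sum_insert) simp_all
  moreover have "hom_sum A X Z (\<lambda>k. f k \<cdot> g) (insert j J)
      = Plus A (f j \<cdot> g) (hom_sum A X Z (\<lambda>k. f k \<cdot> g) J)"
    using insert.hyps insert.prems assms(1,2) Y
      by (intro hom_sum_insert Comp_Hom[where Y = Y]) simp_all
  ultimately show ?case using insert by simp
qed

text \<open>Expanding \<open>u = u \<cdot> 1\<close> along the decomposition gives the sum of the
  \<open>(u \<cdot> a j) \<cdot> b j\<close>. The decomposition of the identity is kept abstract so
  that it covers a biproduct as well as the image of one under an additive functor.\<close>

lemma eq_if_eq_on_sum_Ide:
  assumes "finite J" "\<And>j. j \<in> J \<Longrightarrow> a j \<in> Hom A (Y j) Z" "\<And>j. j \<in> J \<Longrightarrow> b j \<in> Hom A Z (Y j)"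
    and sum: "hom_sum A Z Z (\<lambda>j. a j \<cdot> b j) J = Ide A Z"
    and "u \<in> Hom A Z W" "v \<in> Hom A Z W" "\<And>j. j \<in> J \<Longrightarrow> u \<cdot> a j = v \<cdot> a j"
  shows "u = v"
proof -
  note Z = Hom_Ob[OF assms(5)]
  have ab: "a j \<cdot> b j \<in> Hom A Z Z" if "j \<in> J" for j
    using Comp_Hom[OF assms(3,2)] that by simp
  have *: "w = hom_sum A Z W (\<lambda>j. (w \<cdot> a j) \<cdot> b j) J" if w: "w \<in> Hom A Z W" for w
  proof -
    have "w = w \<cdot> hom_sum A Z Z (\<lambda>j. a j \<cdot> b j) J" using sum w by (simp add: Hom_iff)
    also have "\<dots> = hom_sum A Z W (\<lambda>j. w \<cdot> a j \<cdot> b j) J"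
      using Comp_hom_sum[OF Z(1) w assms(1) ab] by simp
    also have "\<dots> = hom_sum A Z W (\<lambda>j. (w \<cdot> a j) \<cdot> b j) J"
    proof (rule hom_sum_cong)
      fix j assume j: "j \<in> J"
      show "w \<cdot> a j \<cdot> b j \<in> Hom A Z W" using Comp_Hom[OF ab[OF j] w] .
      show "w \<cdot> a j \<cdot> b j = (w \<cdot> a j) \<cdot> b j"
        using Comp_assoc[OF assms(3,2)[OF j] w] by simp
    qed (use Z in auto)
    finally show ?thesis .
  qed
  have "u = hom_sum A Z W (\<lambda>j. (u \<cdot> a j) \<cdot> b j) J" using * assms(5) .
  also have "\<dots> = hom_sum A Z W (\<lambda>j. (v \<cdot> a j) \<cdot> b j) J"
    by (intro hom_sum_cong Z Comp_Hom[OF assms(3) Comp_Hom[OF assms(2) assms(5)]])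
      (simp_all add: assms(7))
  also have "\<dots> = v" using *[OF assms(6)] by simp
  finally show ?thesis .
qed

text \<open>Matrix multiplication through the middle object: \<open>y \<cdot> x\<close> is the sum
  of the products \<open>(y \<cdot> a j) \<cdot> (b j \<cdot> x)\<close>, each with a vanishing
  factor. Which factor vanishes may depend on \<open>j\<close>; the filtration argument uses this
  freedom.\<close>

lemma Comp_eq_Zero_if_sum_Ide:
  assumes "finite J" "\<And>j. j \<in> J \<Longrightarrow> a j \<in> Hom A (Y j) Z" "\<And>j. j \<in> J \<Longrightarrow> b j \<in> Hom A Z (Y j)"
    and sum: "hom_sum A Z Z (\<lambda>j. a j \<cdot> b j) J = Ide A Z"
    and x: "x \<in> Hom A V Z" and y: "y \<in> Hom A Z W"
    and 0: "\<And>j. j \<in> J \<Longrightarrow> y \<cdot> a j = Zero A (Y j) W \<or> b j \<cdot> x = Zero A V (Y j)"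
  shows "y \<cdot> x = Zero A V W"
proof -
  have Ob: "V \<in> Ob A" "W \<in> Ob A" "Z \<in> Ob A" using x y Hom_Ob by auto
  have abx: "(a j \<cdot> b j) \<cdot> x \<in> Hom A V Z" and ab: "a j \<cdot> b j \<in> Hom A Z Z" if "j \<in> J" for j
    using Comp_Hom[OF x Comp_Hom[OF assms(3,2)]] Comp_Hom[OF assms(3,2)] that by simp_all
  have "x = hom_sum A Z Z (\<lambda>j. a j \<cdot> b j) J \<cdot> x" using sum x by (simp add: Hom_iff)
  also have "\<dots> = hom_sum A V Z (\<lambda>j. (a j \<cdot> b j) \<cdot> x) J"
    using hom_sum_Comp[OF Ob(3) x assms(1) ab] by simp
  finally have "y \<cdot> x = y \<cdot> hom_sum A V Z (\<lambda>j. (a j \<cdot> b j) \<cdot> x) J" by (rule arg_cong)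
  also have "\<dots> = hom_sum A V W (\<lambda>j. y \<cdot> (a j \<cdot> b j) \<cdot> x) J"
    by (intro Comp_hom_sum[OF Ob(1) y assms(1)] abx)
  also have "\<dots> = Zero A V W"
  proof (rule hom_sum_Zero[OF Ob(1,2)])
    fix j assume j: "j \<in> J"
    have Yj: "Y j \<in> Ob A" using assms(2)[OF j] Hom_Ob by blast
    have eq: "y \<cdot> (a j \<cdot> b j) \<cdot> x = (y \<cdot> a j) \<cdot> (b j \<cdot> x)"
      using assms(2,3)[OF j] x y by (simp add: Hom_iff)
    show "y \<cdot> (a j \<cdot> b j) \<cdot> x = Zero A V W"
      using 0[OF j]
    proof
      assume "y \<cdot> a j = Zero A (Y j) W"
      then show ?thesis using assms(3)[OF j] x Ob eq by (simp add: Hom_iff)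
    next
      assume "b j \<cdot> x = Zero A V (Y j)"
      then show ?thesis using Comp_Hom[OF assms(2)[OF j] y] Ob eq by (simp add: Hom_iff)
    qed
  qed
  finally show ?thesis .
qed

text \<open>Orthogonality of injections and projections leaves only the k-th term of
  \<open>h \<cdot> \<iota> k\<close>. The arrow is given by an explicit sum because the arrow whose
  cokernel defines \<open>C_ob\<close> has exactly this form.\<close>

lemma biproduct_universal:
  assumes B: "is_biproduct A J X (Z, \<iota>, \<pi>)" and "finite J" "W \<in> Ob A"
    and g: "\<And>j. j \<in> J \<Longrightarrow> g j \<in> Hom A (X j) W"
  defines "h \<equiv> hom_sum A Z W (\<lambda>j. g j \<cdot> \<pi> j) J"
  shows "h \<in> Hom A Z W" "\<And>k. k \<in> J \<Longrightarrow> h \<cdot> \<iota> k = g k"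
proof -
  have Z: "Z \<in> Ob A" and \<iota>: "\<And>j. j \<in> J \<Longrightarrow> \<iota> j \<in> Hom A (X j) Z"
    and \<pi>: "\<And>j. j \<in> J \<Longrightarrow> \<pi> j \<in> Hom A Z (X j)"
    and \<pi>\<iota>: "\<And>j k. \<lbrakk>j \<in> J; k \<in> J\<rbrakk> \<Longrightarrow>
      \<pi> k \<cdot> \<iota> j = (if j = k then Ide A (X j) else Zero A (X j) (X k))"
    using B by (auto simp: is_biproduct_def)
  have g\<pi>: "g j \<cdot> \<pi> j \<in> Hom A Z W" if "j \<in> J" for j
    using Comp_Hom[OF \<pi> g] that by simp
  show "h \<in> Hom A Z W" unfolding h_def using Z assms(3) g\<pi> by (rule hom_sum_Hom)
  fix k assume k: "k \<in> J"
  have Xk: "X k \<in> Ob A" using g[OF k] Hom_Ob by blast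
  have eq: "(g j \<cdot> \<pi> j) \<cdot> \<iota> k = (if j = k then g k else Zero A (X k) W)" if j: "j \<in> J" for j
  proof -
    have Xj: "X j \<in> Ob A" using g[OF j] Hom_Ob by blast
    have "(g j \<cdot> \<pi> j) \<cdot> \<iota> k = g j \<cdot> \<pi> j \<cdot> \<iota> k"
      using g \<pi> \<iota> j k by (intro Comp_assoc)
    then show ?thesis using \<pi>\<iota>[OF k j] Xk Xj g[OF j] by (auto simp: Hom_iff)
  qed
  have "h \<cdot> \<iota> k = hom_sum A (X k) W (\<lambda>j. (g j \<cdot> \<pi> j) \<cdot> \<iota> k) J"
    unfolding h_def using assms(2,3) \<iota>[OF k] g\<pi> by (intro hom_sum_Comp)
  also have "\<dots> = (g k \<cdot> \<pi> k) \<cdot> \<iota> k"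
    using assms(2,3) k Xk eq g by (intro hom_sum_single) auto
  finally show "h \<cdot> \<iota> k = g k" using eq[OF k] by simp
qed

end

section \<open>Additive endofunctors\<close>

locale additive_endofunctor = preadditive_category A + endofunctor A F
  for A :: "('o, 'm, 'x) preadditive_category_scheme" (structure) and F +
  assumes additive: "additive_functor A F"
begin

lemma on_ar_Ar [simp]:
  assumes "f \<in> Ar A"
  shows "on_ar F f \<in> Ar A" "Source A (on_ar F f) = on_ob F (Source A f)"
    "Target A (on_ar F f) = on_ob F (Target A f)"
  using on_ar_Hom[of f "Source A f" "Target A f"] assms by (simp_all add: Hom_iff)

lemma on_ar_Plus:
  assumes "f \<in> Hom A X Y" "g \<in> Hom A X Y"
  shows "on_ar F (Plus A f g) = Plus A (on_ar F f) (on_ar F g)"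
  using additive assms Hom_Ob unfolding additive_functor_def by blast

lemma on_ar_Zero:
  assumes "X \<in> Ob A" "Y \<in> Ob A"
  shows "on_ar F (Zero A X Y) = Zero A (on_ob F X) (on_ob F Y)"
proof -
  note Z = Zero_Hom[OF assms] and FZ = on_ar_Hom[OF Zero_Hom[OF assms]]
  have "Plus A (on_ar F (Zero A X Y)) (on_ar F (Zero A X Y)) = on_ar F (Zero A X Y)"
    using on_ar_Plus[OF Z Z] Plus_Zero[OF Z] by simp
  also have "\<dots> = Plus A (on_ar F (Zero A X Y)) (Zero A (on_ob F X) (on_ob F Y))"
    using Plus_Zero[OF FZ] by simp
  finally show ?thesis
    using Plus_cancel[OF FZ FZ Zero_Hom[OF on_ob_Ob[OF assms(1)] on_ob_Ob[OF assms(2)]]] by simp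
qed

lemma on_ar_hom_sum:
  assumes "X \<in> Ob A" "Y \<in> Ob A" "finite J" "\<And>k. k \<in> J \<Longrightarrow> f k \<in> Hom A X Y"
  shows "on_ar F (hom_sum A X Y f J) = hom_sum A (on_ob F X) (on_ob F Y) (\<lambda>k. on_ar F (f k)) J"
  using assms(3,4)
proof (induction J)
  case empty
  show ?case using assms(1,2) on_ob_Ob by (simp add: hom_sum_empty on_ar_Zero)
next
  case (insert j J)
  have "on_ar F (Plus A (f j) (hom_sum A X Y f J))
      = Plus A (on_ar F (f j)) (on_ar F (hom_sum A X Y f J))"
    using insert.prems assms(1,2) by (intro on_ar_Plus[where X = X and Y = Y] hom_sum_Hom) simp_all
  moreover have "hom_sum A X Y f (insert j J) = Plus A (f j) (hom_sum A X Y f J)"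
    using insert.prems insert.hyps assms(1,2) by (intro hom_sum_insert) simp_all
  moreover have "hom_sum A (on_ob F X) (on_ob F Y) (\<lambda>k. on_ar F (f k)) (insert j J)
      = Plus A (on_ar F (f j)) (hom_sum A (on_ob F X) (on_ob F Y) (\<lambda>k. on_ar F (f k)) J)"
    using insert.prems insert.hyps assms(1,2)
    by (intro hom_sum_insert on_ob_Ob on_ar_Hom) simp_all
  ultimately show ?case using insert by simp
qed

text \<open>Additive functors respect sums, composites and identities. This is the sense in which
  \<open>F\<close> of a direct sum is the direct sum of the images.\<close>

lemma on_ar_sum_Ide:
  assumes "finite J" "\<And>j. j \<in> J \<Longrightarrow> a j \<in> Hom A (Y j) Z" "\<And>j. j \<in> J \<Longrightarrow> b j \<in> Hom A Z (Y j)"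
    and sum: "hom_sum A Z Z (\<lambda>j. a j \<cdot> b j) J = Ide A Z" and Z: "Z \<in> Ob A"
  shows "hom_sum A (on_ob F Z) (on_ob F Z) (\<lambda>j. on_ar F (a j) \<cdot> on_ar F (b j)) J
    = Ide A (on_ob F Z)"
proof -
  have ab: "a j \<cdot> b j \<in> Hom A Z Z" if "j \<in> J" for j
    using Comp_Hom[OF assms(3,2)] that by simp
  have "Ide A (on_ob F Z) = on_ar F (hom_sum A Z Z (\<lambda>j. a j \<cdot> b j) J)"
    using on_ar_Ide[OF Z] sum by simp
  also have "\<dots> = hom_sum A (on_ob F Z) (on_ob F Z) (\<lambda>j. on_ar F (a j \<cdot> b j)) J"
    by (intro on_ar_hom_sum[OF Z Z assms(1)] ab)
  also have "\<dots> = hom_sum A (on_ob F Z) (on_ob F Z) (\<lambda>j. on_ar F (a j) \<cdot> on_ar F (b j)) J"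
  proof (rule hom_sum_cong)
    fix j assume j: "j \<in> J"
    show "on_ar F (a j \<cdot> b j) \<in> Hom A (on_ob F Z) (on_ob F Z)" using on_ar_Hom[OF ab[OF j]] .
    show "on_ar F (a j \<cdot> b j) = on_ar F (a j) \<cdot> on_ar F (b j)"
      using on_ar_Comp[OF assms(3,2)] j by simp
  qed (use on_ob_Ob[OF Z] in auto)
  finally show ?thesis by simp
qed

end

text \<open>The axiom on composites of structure maps compares arrows out of F_i F_j T(Z). With the
  composite as an additive endofunctor, these can be tested on summands just like arrows out of F_i
  T(Z).\<close>

lemma additive_endofunctor_comp:
  assumes "additive_endofunctor A F" "additive_endofunctor A G"
  shows "additive_endofunctor A (functor_comp F G)"
proof -
  interpret F: additive_endofunctor A F by fact
  interpret G: additive_endofunctor A G by fact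
  show ?thesis
  proof
    fix f g X Y Z assume f: "f \<in> Hom A X Y" and g: "g \<in> Hom A Y Z"
    show "on_ar (functor_comp F G) (g \<cdot>\<^bsub>A\<^esub> f)
        = on_ar (functor_comp F G) g \<cdot>\<^bsub>A\<^esub> on_ar (functor_comp F G) f"
      by (simp add: functor_comp_def G.on_ar_Comp[OF f g]
          F.on_ar_Comp[OF G.on_ar_Hom[OF f] G.on_ar_Hom[OF g]])
  next
    show "additive_functor A (functor_comp F G)"
      unfolding additive_functor_def
    proof (intro ballI)
      fix X Y f g assume "f \<in> Hom A X Y" "g \<in> Hom A X Y"
      then show "on_ar (functor_comp F G) (Plus A f g)
          = Plus A (on_ar (functor_comp F G) f) (on_ar (functor_comp F G) g)"
        using F.on_ar_Plus[OF G.on_ar_Hom G.on_ar_Hom] G.on_ar_Plus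
        by (simp add: functor_comp_def)
    qed
  qed (simp_all add: functor_comp_def F.on_ob_Ob G.on_ob_Ob F.on_ar_Hom G.on_ar_Hom
      F.on_ar_Ide G.on_ar_Ide)
qed

section \<open>Coproducts\<close>

lemma coproduct_inj: "\<lbrakk>is_coproduct K J X \<iota> Z; j \<in> J\<rbrakk> \<Longrightarrow> \<iota> j \<in> Hom K (X j) Z"
  unfolding is_coproduct_def by blast

context category
begin

text \<open>Used to identify an arbitrary coproduct of copies of T(P) with T(Z), where Z is the
  coproduct of copies of P obtained through C.\<close>

lemma coproduct_isomorphic:
  assumes Z: "is_coproduct K J X \<iota> Z" and Z': "is_coproduct K J X \<iota>' Z'"
  shows "isomorphic_obs K Z Z'"
proof -
  have ex: "\<exists>h \<in> Hom K U V. \<forall>j \<in> J. h \<cdot> i j = i' j"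
    if "is_coproduct K J X i U" "is_coproduct K J X i' V" for U V i i'
  proof -
    have "\<exists>!h. h \<in> Hom K U V \<and> (\<forall>j \<in> J. h \<cdot> i j = i' j)"
      using that(2) by (intro coproduct_universal[OF that(1)]) (auto simp: is_coproduct_def)
    then show ?thesis by blast
  qed
  have inv: "b \<cdot> a = Ide K U"
    if U: "is_coproduct K J X i U" and V: "is_coproduct K J X i' V" and a: "a \<in> Hom K U V"
      and b: "b \<in> Hom K V U" and ai: "\<forall>j \<in> J. a \<cdot> i j = i' j" and bi: "\<forall>j \<in> J. b \<cdot> i' j = i j"
    for U V i i' a b
  proof -
    have i: "\<And>j. j \<in> J \<Longrightarrow> i j \<in> Hom K (X j) U" and Ob: "U \<in> Ob K"
      using U by (auto simp: is_coproduct_def)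
    have "\<exists>!h. h \<in> Hom K U U \<and> (\<forall>j \<in> J. h \<cdot> i j = i j)"
      using i Ob by (intro coproduct_universal[OF U])
    moreover have "b \<cdot> a \<in> Hom K U U" "Ide K U \<in> Hom K U U"
      using Comp_Hom[OF a b] Ide_Hom[OF Ob] .
    moreover have "\<forall>j \<in> J. (b \<cdot> a) \<cdot> i j = i j"
      using Comp_assoc[OF i a b] ai bi by simp
    moreover have "\<forall>j \<in> J. Ide K U \<cdot> i j = i j"
      using i Ide_left by blast
    ultimately show ?thesis by blast
  qed
  obtain a b where "a \<in> Hom K Z Z'" "\<forall>j \<in> J. a \<cdot> \<iota> j = \<iota>' j"
    "b \<in> Hom K Z' Z" "\<forall>j \<in> J. b \<cdot> \<iota>' j = \<iota> j"
    using ex[OF Z Z'] ex[OF Z' Z] by blast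
  then show ?thesis
    using inv[OF Z Z', of a b] inv[OF Z' Z, of b a] Z Z'
    unfolding isomorphic_obs_def is_coproduct_def by blast
qed

end

section \<open>The right n-trivial extension\<close>

lemma ext_hom_iff:
  "\<gamma> \<in> ext_hom A n F x y \<longleftrightarrow> \<gamma> \<in> Hom A (fst x) (fst y) \<and>
     (\<forall>i \<in> {1..n}. \<gamma> \<cdot>\<^bsub>A\<^esub> snd x i = snd y i \<cdot>\<^bsub>A\<^esub> on_ar (F i) \<gamma>)"
  by (simp add: ext_hom_def split_beta)

locale trivial_extension_data = abelian_category A
  for A :: "('o, 'm, 'x) preadditive_category_scheme" (structure) +
  fixes n :: nat and F :: "nat \<Rightarrow> ('o, 'm) endofunctor" and \<Phi> :: "nat \<Rightarrow> nat \<Rightarrow> 'o \<Rightarrow> 'm"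
  assumes F_additive: "i \<in> {1..n} \<Longrightarrow> additive_endofunctor A (F i)"
    and \<Phi>_natural: "\<lbrakk>i \<in> {1..n}; j \<in> {1..n}; i + j \<in> {1..n}\<rbrakk>
           \<Longrightarrow> natural_transformation A (functor_comp (F i) (F j)) (F (i + j)) (\<Phi> i j)"
    and \<Phi>_associative: "associative_family A n F \<Phi>"
begin

abbreviation "E \<equiv> trivial_extension A n F \<Phi>"
abbreviation "obs \<equiv> ext_obs A n F \<Phi>"
abbreviation "mor \<equiv> ext_hom A n F"

lemma F_Ob [simp]: "\<lbrakk>i \<in> {1..n}; X \<in> Ob A\<rbrakk> \<Longrightarrow> on_ob (F i) X \<in> Ob A"
  using endofunctor.on_ob_Ob[OF additive_endofunctor.axioms(2)[OF F_additive]] .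

lemma F_Hom: "\<lbrakk>i \<in> {1..n}; f \<in> Hom A X Y\<rbrakk> \<Longrightarrow> on_ar (F i) f \<in> Hom A (on_ob (F i) X) (on_ob (F i) Y)"
  using endofunctor.on_ar_Hom[OF additive_endofunctor.axioms(2)[OF F_additive]] .

lemma F_Comp:
  "\<lbrakk>i \<in> {1..n}; f \<in> Hom A X Y; g \<in> Hom A Y Z\<rbrakk> \<Longrightarrow> on_ar (F i) (g \<cdot> f) = on_ar (F i) g \<cdot> on_ar (F i) f"
  using endofunctor.on_ar_Comp[OF additive_endofunctor.axioms(2)[OF F_additive]] .

lemma F_Ide: "\<lbrakk>i \<in> {1..n}; X \<in> Ob A\<rbrakk> \<Longrightarrow> on_ar (F i) (Ide A X) = Ide A (on_ob (F i) X)"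
  using endofunctor.on_ar_Ide[OF additive_endofunctor.axioms(2)[OF F_additive]] .

lemmas F_Zero = additive_endofunctor.on_ar_Zero[OF F_additive]
lemmas F_Plus = additive_endofunctor.on_ar_Plus[OF F_additive]

lemma F_Ar [simp]:
  assumes "i \<in> {1..n}" "f \<in> Ar A"
  shows "on_ar (F i) f \<in> Ar A" "Source A (on_ar (F i) f) = on_ob (F i) (Source A f)"
    "Target A (on_ar (F i) f) = on_ob (F i) (Target A f)"
  using F_Hom[of i f "Source A f" "Target A f"] assms by (simp_all add: Hom_iff)

lemma \<Phi>_Hom:
  assumes "i \<in> {1..n}" "j \<in> {1..n}" "i + j \<le> n" "X \<in> Ob A"
  shows "\<Phi> i j X \<in> Hom A (on_ob (F i) (on_ob (F j) X)) (on_ob (F (i + j)) X)"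
  using \<Phi>_natural[of i j] assms by (simp add: natural_transformation_def functor_comp_def)

lemma \<Phi>_Ar [simp]:
  assumes "i \<in> {1..n}" "j \<in> {1..n}" "i + j \<le> n" "X \<in> Ob A"
  shows "\<Phi> i j X \<in> Ar A" "Source A (\<Phi> i j X) = on_ob (F i) (on_ob (F j) X)"
    "Target A (\<Phi> i j X) = on_ob (F (i + j)) X"
  using \<Phi>_Hom[OF assms] by (simp_all add: Hom_iff)

lemma \<Phi>_nat:
  assumes "i \<in> {1..n}" "j \<in> {1..n}" "i + j \<le> n" "h \<in> Hom A X Y"
  shows "\<Phi> i j Y \<cdot> on_ar (F i) (on_ar (F j) h) = on_ar (F (i + j)) h \<cdot> \<Phi> i j X"
  using \<Phi>_natural[of i j] assms Hom_Ob[OF assms(4)]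
  by (auto simp add: natural_transformation_def functor_comp_def)

lemma obsD:
  assumes "x \<in> obs"
  shows "fst x \<in> Ob A"
    and "\<And>i. i \<in> {1..n} \<Longrightarrow> snd x i \<in> Hom A (on_ob (F i) (fst x)) (fst x)"
    and "\<And>i j. \<lbrakk>i \<in> {1..n}; j \<in> {1..n}; i + j \<le> n\<rbrakk>
      \<Longrightarrow> snd x i \<cdot> on_ar (F i) (snd x j) = snd x (i + j) \<cdot> \<Phi> i j (fst x)"
    and "\<And>i j. \<lbrakk>i \<in> {1..n}; j \<in> {1..n}; \<not> i + j \<le> n\<rbrakk>
      \<Longrightarrow> snd x i \<cdot> on_ar (F i) (snd x j) = Zero A (on_ob (F i) (on_ob (F j) (fst x))) (fst x)"
proof -
  obtain X f where x: "x = (X, f)" by fastforce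
  note ext = assms[unfolded x ext_obs_def mem_Collect_eq prod.case]
  show "fst x \<in> Ob A" using ext x by simp
  show "snd x i \<in> Hom A (on_ob (F i) (fst x)) (fst x)" if "i \<in> {1..n}" for i
    using PiE_mem[OF conjunct1[OF conjunct2[OF ext]] that] x by simp
  note eq = bspec[OF bspec[OF conjunct2[OF conjunct2[OF ext]]]]
  show "snd x i \<cdot> on_ar (F i) (snd x j) = snd x (i + j) \<cdot> \<Phi> i j (fst x)"
    if "i \<in> {1..n}" "j \<in> {1..n}" "i + j \<le> n" for i j
    using eq[OF that(1,2)] that(3) x by simp
  show "snd x i \<cdot> on_ar (F i) (snd x j) = Zero A (on_ob (F i) (on_ob (F j) (fst x))) (fst x)"
    if "i \<in> {1..n}" "j \<in> {1..n}" "\<not> i + j \<le> n" for i j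
    using eq[OF that(1,2)] that(3) x by simp
qed

lemma obs_Ar [simp]:
  assumes "x \<in> obs" "i \<in> {1..n}"
  shows "snd x i \<in> Ar A" "Source A (snd x i) = on_ob (F i) (fst x)" "Target A (snd x i) = fst x"
  using obsD(2)[OF assms] by (simp_all add: Hom_iff)

lemma hom_Hom: "\<gamma> \<in> mor x y \<Longrightarrow> \<gamma> \<in> Hom A (fst x) (fst y)"
  by (simp add: ext_hom_iff)

lemma hom_eq: "\<lbrakk>\<gamma> \<in> mor x y; i \<in> {1..n}\<rbrakk> \<Longrightarrow> \<gamma> \<cdot> snd x i = snd y i \<cdot> on_ar (F i) \<gamma>"
  unfolding ext_hom_iff by blast

lemma homI:
  assumes "\<gamma> \<in> Hom A (fst x) (fst y)" "\<And>i. i \<in> {1..n} \<Longrightarrow> \<gamma> \<cdot> snd x i = snd y i \<cdot> on_ar (F i) \<gamma>"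
  shows "\<gamma> \<in> mor x y"
  using assms unfolding ext_hom_iff by blast

lemma hom_Comp:
  assumes "x \<in> obs" "y \<in> obs" "z \<in> obs" and \<gamma>: "\<gamma> \<in> mor x y" and \<delta>: "\<delta> \<in> mor y z"
  shows "\<delta> \<cdot> \<gamma> \<in> mor x z"
proof (rule homI)
  note H = hom_Hom[OF \<gamma>] hom_Hom[OF \<delta>]
  show "\<delta> \<cdot> \<gamma> \<in> Hom A (fst x) (fst z)" using Comp_Hom[OF H] .
  fix i assume i: "i \<in> {1..n}"
  note X = obsD(2)[OF assms(1) i] obsD(2)[OF assms(2) i] obsD(2)[OF assms(3) i]
    and FH = F_Hom[OF i H(1)] F_Hom[OF i H(2)]
  have "(\<delta> \<cdot> \<gamma>) \<cdot> snd x i = \<delta> \<cdot> snd y i \<cdot> on_ar (F i) \<gamma>"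
    using Comp_assoc[OF X(1) H] hom_eq[OF \<gamma> i] by simp
  also have "\<dots> = (\<delta> \<cdot> snd y i) \<cdot> on_ar (F i) \<gamma>"
    using Comp_assoc[OF FH(1) X(2) H(2)] by simp
  also have "\<dots> = snd z i \<cdot> on_ar (F i) (\<delta> \<cdot> \<gamma>)"
    using Comp_assoc[OF FH X(3)] hom_eq[OF \<delta> i] F_Comp[OF i H] by simp
  finally show "(\<delta> \<cdot> \<gamma>) \<cdot> snd x i = snd z i \<cdot> on_ar (F i) (\<delta> \<cdot> \<gamma>)" .
qed

lemma hom_Ide: "x \<in> obs \<Longrightarrow> Ide A (fst x) \<in> mor x x"
  using obsD(1,2) by (intro homI) (simp_all add: Ide_Hom F_Ide)

lemma hom_Zero:
  assumes "x \<in> obs" "y \<in> obs"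
  shows "Zero A (fst x) (fst y) \<in> mor x y"
  using assms obsD(1) by (intro homI) (simp_all add: Zero_Hom F_Zero)

text \<open>\<open>F i\<close> turns \<open>\<gamma> \<cdot> \<delta> = 1\<close> into an identity
  that inserts the commuting square of \<open>\<gamma>\<close> into
  \<open>\<delta> \<cdot> snd y i\<close>; then \<open>\<delta> \<cdot> \<gamma> = 1\<close> removes
  it. So invertibility in the extension can be decided in \<open>A\<close>.\<close>

lemma hom_inverse:
  assumes x: "x \<in> obs" and y: "y \<in> obs" and \<gamma>: "\<gamma> \<in> mor x y" and \<delta>: "\<delta> \<in> Hom A (fst y) (fst x)"
    and inv: "\<delta> \<cdot> \<gamma> = Ide A (fst x)" "\<gamma> \<cdot> \<delta> = Ide A (fst y)"
  shows "\<delta> \<in> mor y x"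
proof (rule homI[OF \<delta>])
  fix i assume i: "i \<in> {1..n}"
  note X = obsD(1)[OF x] obsD(1)[OF y] and g = hom_Hom[OF \<gamma>]
  have F1: "on_ar (F i) \<gamma> \<cdot> on_ar (F i) \<delta> = Ide A (on_ob (F i) (fst y))"
    using F_Comp[OF i \<delta> g] F_Ide[OF i X(2)] inv by simp
  have "\<delta> \<cdot> snd y i = \<delta> \<cdot> snd y i \<cdot> on_ar (F i) \<gamma> \<cdot> on_ar (F i) \<delta>"
    using F1 y i by simp
  also have "\<dots> = \<delta> \<cdot> (snd y i \<cdot> on_ar (F i) \<gamma>) \<cdot> on_ar (F i) \<delta>"
    using y i g \<delta> by (simp add: Hom_iff)
  also have "\<dots> = \<delta> \<cdot> (\<gamma> \<cdot> snd x i) \<cdot> on_ar (F i) \<delta>"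
    using hom_eq[OF \<gamma> i] by simp
  also have "\<dots> = (\<delta> \<cdot> \<gamma>) \<cdot> snd x i \<cdot> on_ar (F i) \<delta>"
    using x i g \<delta> by (simp add: Hom_iff)
  also have "\<dots> = snd x i \<cdot> on_ar (F i) \<delta>"
    using x i g \<delta> inv by (simp add: Hom_iff)
  finally show "\<delta> \<cdot> snd y i = snd x i \<cdot> on_ar (F i) \<delta>" .
qed

text \<open>Additivity of \<open>F i\<close> makes both sides of the commuting square additive in
  the arrow, so the square of \<open>u\<close> cancels from the square of the sum. Applied with the
  identity as sum, this makes \<open>M = 1 - u\<close> a morphism.\<close>

lemma hom_complement:
  assumes x: "x \<in> obs" and y: "y \<in> obs" and u: "u \<in> mor x y" and M: "M \<in> Hom A (fst x) (fst y)"
    and uM: "Plus A u M \<in> mor x y"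
  shows "M \<in> mor x y"
proof (rule homI[OF M])
  fix i assume i: "i \<in> {1..n}"
  note u' = hom_Hom[OF u] and X = obsD(2)[OF x i] obsD(2)[OF y i]
  note Fu = F_Hom[OF i u'] F_Hom[OF i M]
  have "Plus A (u \<cdot> snd x i) (M \<cdot> snd x i) = Plus A u M \<cdot> snd x i"
    using Comp_Plus_left[OF X(1) u' M] by simp
  also have "\<dots> = snd y i \<cdot> Plus A (on_ar (F i) u) (on_ar (F i) M)"
    using hom_eq[OF uM i] F_Plus[OF i u' M] by simp
  also have "\<dots> = Plus A (u \<cdot> snd x i) (snd y i \<cdot> on_ar (F i) M)"
    using Comp_Plus_right[OF Fu X(2)] hom_eq[OF u i] by simp
  finally show "M \<cdot> snd x i = snd y i \<cdot> on_ar (F i) M"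
    using Plus_cancel[OF Comp_Hom[OF X(1) u'] Comp_Hom[OF X(1) M] Comp_Hom[OF Fu(2) X(2)]] by simp
qed

section \<open>The extension as a category, its coproducts and retracts\<close>

lemma E_simps [simp]:
  "Ob E = obs" "Ide E x = (x, x, Ide A (fst x))"
  "(y, z, \<delta>) \<cdot>\<^bsub>E\<^esub> (x, y', \<gamma>) = (x, z, \<delta> \<cdot> \<gamma>)"
  by (simp_all add: trivial_extension_def)

lemma Hom_E_iff [simp]:
  "(x', y', \<gamma>) \<in> Hom E x y \<longleftrightarrow> x' = x \<and> y' = y \<and> x \<in> obs \<and> y \<in> obs \<and> \<gamma> \<in> mor x y"
  by (auto simp: trivial_extension_def Hom_def)

lemma Hom_E_cases:
  assumes "t \<in> Hom E x y"
  obtains \<gamma> where "t = (x, y, \<gamma>)" "x \<in> obs" "y \<in> obs" "\<gamma> \<in> mor x y"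
  using assms by (cases t) auto

text \<open>The tags of an arrow between fixed objects are forced, so universal properties pass back
  and forth between tagged triples and underlying arrows of \<open>A\<close>.\<close>

lemma ex1_Hom_E_iff:
  assumes "x \<in> obs" "y \<in> obs"
  shows "(\<exists>!t. t \<in> Hom E x y \<and> Q t) \<longleftrightarrow> (\<exists>!\<gamma>. \<gamma> \<in> mor x y \<and> Q (x, y, \<gamma>))"
proof
  assume "\<exists>!t. t \<in> Hom E x y \<and> Q t"
  then obtain t where t: "t \<in> Hom E x y" "Q t" and uniq: "\<And>t'. t' \<in> Hom E x y \<and> Q t' \<Longrightarrow> t' = t"
    by blast
  from t(1) obtain \<gamma> where \<gamma>: "t = (x, y, \<gamma>)" "\<gamma> \<in> mor x y" by (elim Hom_E_cases)
  show "\<exists>!\<gamma>. \<gamma> \<in> mor x y \<and> Q (x, y, \<gamma>)"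
  proof (rule ex1I[of _ \<gamma>])
    show "\<delta> = \<gamma>" if "\<delta> \<in> mor x y \<and> Q (x, y, \<delta>)" for \<delta>
      using uniq[of "(x, y, \<delta>)"] that assms \<gamma>(1) by simp
  qed (use \<gamma> t in simp)
next
  assume "\<exists>!\<gamma>. \<gamma> \<in> mor x y \<and> Q (x, y, \<gamma>)"
  then obtain \<gamma> where \<gamma>: "\<gamma> \<in> mor x y" "Q (x, y, \<gamma>)"
    and uniq: "\<And>\<delta>. \<delta> \<in> mor x y \<and> Q (x, y, \<delta>) \<Longrightarrow> \<delta> = \<gamma>"
    by blast
  show "\<exists>!t. t \<in> Hom E x y \<and> Q t"
  proof (rule ex1I[of _ "(x, y, \<gamma>)"])
    show "t = (x, y, \<gamma>)" if "t \<in> Hom E x y \<and> Q t" for t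
      using that uniq by (auto elim!: Hom_E_cases)
  qed (use \<gamma> assms in simp)
qed

lemma category_E: "category E"
proof
  fix f assume "f \<in> Ar E"
  then show "Source E f \<in> Ob E" "Target E f \<in> Ob E" by (auto simp: trivial_extension_def)
next
  fix x assume "x \<in> Ob E"
  then show "Ide E x \<in> Hom E x x" by (simp add: hom_Ide)
next
  fix f g x y z assume "f \<in> Hom E x y" "g \<in> Hom E y z"
  then show "g \<cdot>\<^bsub>E\<^esub> f \<in> Hom E x z" by (elim Hom_E_cases) (simp add: hom_Comp)
next
  fix f g h w x y z assume "f \<in> Hom E w x" "g \<in> Hom E x y" "h \<in> Hom E y z"
  then show "(h \<cdot>\<^bsub>E\<^esub> g) \<cdot>\<^bsub>E\<^esub> f = h \<cdot>\<^bsub>E\<^esub> g \<cdot>\<^bsub>E\<^esub> f"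
    by (elim Hom_E_cases) (simp add: Comp_assoc[OF hom_Hom hom_Hom hom_Hom])
next
  fix f x y assume "f \<in> Hom E x y"
  then show "Ide E y \<cdot>\<^bsub>E\<^esub> f = f" by (elim Hom_E_cases) (simp add: Ide_left[OF hom_Hom])
next
  fix f x y assume "f \<in> Hom E x y"
  then show "f \<cdot>\<^bsub>E\<^esub> Ide E x = f" by (elim Hom_E_cases) (simp add: Ide_right[OF hom_Hom])
qed

text \<open>Strips the tags: \<open>\<gamma> j\<close> is the third component of
  \<open>\<iota> j\<close>. Coproducts in the extension are handled through untagged arrows from
  here on, and \<open>coproduct_E_I\<close> puts the tags back.\<close>

lemma coproduct_E_D:
  assumes "is_coproduct E J x \<iota> z"
  obtains \<gamma> where "z \<in> obs" "\<forall>j \<in> J. x j \<in> obs" "\<forall>j \<in> J. \<gamma> j \<in> mor (x j) z"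
    "\<forall>w \<in> obs. \<forall>g. (\<forall>j \<in> J. g j \<in> mor (x j) w) \<longrightarrow>
      (\<exists>!h. h \<in> mor z w \<and> (\<forall>j \<in> J. h \<cdot> \<gamma> j = g j))"
proof
  have z: "z \<in> obs" and \<iota>: "\<And>j. j \<in> J \<Longrightarrow> \<iota> j \<in> Hom E (x j) z"
    using assms by (auto simp: is_coproduct_def)
  show "z \<in> obs" by fact
  have \<iota>': "\<iota> j = (x j, z, snd (snd (\<iota> j)))" "x j \<in> obs" "snd (snd (\<iota> j)) \<in> mor (x j) z"
    if "j \<in> J" for j
    using \<iota>[OF that] by (auto elim: Hom_E_cases)
  show "\<forall>j \<in> J. x j \<in> obs" "\<forall>j \<in> J. snd (snd (\<iota> j)) \<in> mor (x j) z"
    using \<iota>'(2,3) by simp_all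
  show "\<forall>w \<in> obs. \<forall>g. (\<forall>j \<in> J. g j \<in> mor (x j) w) \<longrightarrow>
      (\<exists>!h. h \<in> mor z w \<and> (\<forall>j \<in> J. h \<cdot> snd (snd (\<iota> j)) = g j))"
  proof (intro ballI allI impI)
    fix w g assume w: "w \<in> obs" and g: "\<forall>j \<in> J. g j \<in> mor (x j) w"
    have "\<exists>!h. h \<in> Hom E z w \<and> (\<forall>j \<in> J. h \<cdot>\<^bsub>E\<^esub> \<iota> j = (x j, w, g j))"
      using \<iota>' g w by (intro coproduct_universal[OF assms]) simp_all
    moreover have "(z, w, h) \<cdot>\<^bsub>E\<^esub> \<iota> j = (x j, w, h \<cdot> snd (snd (\<iota> j)))" if "j \<in> J" for h j
      using \<iota>'(1)[OF that] E_simps(3) by metis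
    ultimately show "\<exists>!h. h \<in> mor z w \<and> (\<forall>j \<in> J. h \<cdot> snd (snd (\<iota> j)) = g j)"
      by (simp add: ex1_Hom_E_iff[OF z w])
  qed
qed

lemma coproduct_E_I:
  assumes z: "z \<in> obs" and x: "\<And>j. j \<in> J \<Longrightarrow> x j \<in> obs"
    and \<gamma>: "\<And>j. j \<in> J \<Longrightarrow> \<gamma> j \<in> mor (x j) z"
    and univ: "\<And>w g. \<lbrakk>w \<in> obs; \<And>j. j \<in> J \<Longrightarrow> g j \<in> mor (x j) w\<rbrakk>
      \<Longrightarrow> \<exists>!h. h \<in> mor z w \<and> (\<forall>j \<in> J. h \<cdot> \<gamma> j = g j)"
  shows "is_coproduct E J x (\<lambda>j. (x j, z, \<gamma> j)) z"
  unfolding is_coproduct_def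
proof (intro conjI ballI allI impI)
  show "z \<in> Ob E" using z by simp
  show "(x j, z, \<gamma> j) \<in> Hom E (x j) z" if "j \<in> J" for j using z x \<gamma> that by simp
  fix w f assume w: "w \<in> Ob E" and f: "\<forall>j \<in> J. f j \<in> Hom E (x j) w"
  define g where "g j = snd (snd (f j))" for j
  have g: "g j \<in> mor (x j) w" "f j = (x j, w, g j)" if "j \<in> J" for j
    using bspec[OF f that] by (auto simp: g_def elim!: Hom_E_cases)
  have "\<exists>!h. h \<in> mor z w \<and> (\<forall>j \<in> J. h \<cdot> \<gamma> j = g j)" using w g(1) by (intro univ) simp_all
  then show "\<exists>!h. h \<in> Hom E z w \<and> (\<forall>j \<in> J. h \<cdot>\<^bsub>E\<^esub> (x j, z, \<gamma> j) = f j)"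
    using ex1_Hom_E_iff[OF z, of w] w g(2) by simp
qed

text \<open>The universal property, applied to the identity on \<open>x\<close> and the zero arrow
  on the complement, yields the retraction; the zero arrow is a morphism because the
  \<open>F i\<close> preserve zero.\<close>

lemma direct_summand_E_retract:
  assumes "is_direct_summand E x z"
  obtains i r where "i \<in> mor x z" "r \<in> mor z x" "r \<cdot> i = Ide A (fst x)"
proof -
  obtain y \<iota> where cop: "is_coproduct E (UNIV :: bool set) (\<lambda>b. if b then x else y) \<iota> z"
    using assms unfolding is_direct_summand_def by blast
  obtain \<gamma> where "z \<in> obs" and xy: "\<forall>b \<in> UNIV. (if b then x else y) \<in> obs"
    and \<gamma>: "\<forall>b \<in> UNIV. \<gamma> b \<in> mor (if b then x else y) z"
    and univ: "\<forall>w \<in> obs. \<forall>g. (\<forall>b \<in> UNIV. g b \<in> mor (if b then x else y) w) \<longrightarrow>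
      (\<exists>!h. h \<in> mor z w \<and> (\<forall>b \<in> UNIV. h \<cdot> \<gamma> b = g b))"
    using cop by (rule coproduct_E_D)
  have x: "x \<in> obs" and y: "y \<in> obs" using bspec[OF xy, of True] bspec[OF xy, of False] by simp_all
  have "\<exists>!h. h \<in> mor z x \<and> (\<forall>b \<in> UNIV. h \<cdot> \<gamma> b =
      (if b then Ide A (fst x) else Zero A (fst y) (fst x)))"
    using hom_Ide[OF x] hom_Zero[OF y x] by (intro univ[rule_format]) (simp_all add: x)
  then have "\<exists>r. r \<in> mor z x \<and> (\<forall>b \<in> UNIV. r \<cdot> \<gamma> b =
      (if b then Ide A (fst x) else Zero A (fst y) (fst x)))"
    by (rule ex1_implies_ex)
  then obtain r where "r \<in> mor z x" "r \<cdot> \<gamma> True = Ide A (fst x)" by auto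
  then show ?thesis using that bspec[OF \<gamma>, of True] by simp
qed

section \<open>Free objects and cokernels\<close>

text \<open>A universal arrow from \<open>Z\<close> to the forgetful functor (X,f) |-> X: the value
  of its left adjoint at \<open>Z\<close> together with the unit, up to isomorphism.\<close>

definition free_ext :: "('o, 'm) ext_ob \<Rightarrow> 'o \<Rightarrow> 'm \<Rightarrow> bool" where
  "free_ext x Z \<eta> \<longleftrightarrow> x \<in> obs \<and> \<eta> \<in> Hom A Z (fst x) \<and>
     (\<forall>y \<in> obs. \<forall>g \<in> Hom A Z (fst y). \<exists>!h. h \<in> mor x y \<and> h \<cdot> \<eta> = g)"

text \<open>A universal arrow from \<open>x\<close> to the embedding D |-> (D,0), since the arrows
  that kill all structure maps are the morphisms to (D,0), see \<open>mor_zero_ext_iff\<close>. The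
  condition is componentwise, so that the direct sum inside \<open>C_ob\<close> does not
  appear.\<close>

definition cokernel_ext :: "('o, 'm) ext_ob \<Rightarrow> 'o \<Rightarrow> 'm \<Rightarrow> bool" where
  "cokernel_ext x B p \<longleftrightarrow> x \<in> obs \<and> p \<in> Hom A (fst x) B \<and>
     (\<forall>i \<in> {1..n}. p \<cdot> snd x i = Zero A (on_ob (F i) (fst x)) B) \<and>
     (\<forall>D. \<forall>h \<in> Hom A (fst x) D.
        (\<forall>i \<in> {1..n}. h \<cdot> snd x i = Zero A (on_ob (F i) (fst x)) D) \<longrightarrow>
        (\<exists>!u. u \<in> Hom A B D \<and> u \<cdot> p = h))"

lemma free_extD:
  assumes "free_ext x Z \<eta>"
  shows "x \<in> obs" "\<eta> \<in> Hom A Z (fst x)" "Z \<in> Ob A"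
    and "\<And>y g. \<lbrakk>y \<in> obs; g \<in> Hom A Z (fst y)\<rbrakk> \<Longrightarrow> \<exists>h. h \<in> mor x y \<and> h \<cdot> \<eta> = g"
    and "\<And>y h h'. \<lbrakk>y \<in> obs; h \<in> mor x y; h' \<in> mor x y; h \<cdot> \<eta> = h' \<cdot> \<eta>\<rbrakk> \<Longrightarrow> h = h'"
proof -
  show x: "x \<in> obs" and \<eta>: "\<eta> \<in> Hom A Z (fst x)" using assms by (simp_all add: free_ext_def)
  show "Z \<in> Ob A" using Hom_Ob(1)[OF \<eta>] .
  have univ: "\<exists>!h. h \<in> mor x y \<and> h \<cdot> \<eta> = g" if "y \<in> obs" "g \<in> Hom A Z (fst y)" for y g
    using assms that unfolding free_ext_def by simp
  show "\<exists>h. h \<in> mor x y \<and> h \<cdot> \<eta> = g" if "y \<in> obs" "g \<in> Hom A Z (fst y)" for y g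
    using univ[OF that] by (rule ex1_implies_ex)
  show "h = h'" if "y \<in> obs" "h \<in> mor x y" "h' \<in> mor x y" "h \<cdot> \<eta> = h' \<cdot> \<eta>" for y h h'
    using univ[OF that(1) Comp_Hom[OF \<eta> hom_Hom[OF that(2)]]] that(2-4) by (elim ex1E) metis
qed

lemma cokernel_extD:
  assumes "cokernel_ext x B p"
  shows "x \<in> obs" "p \<in> Hom A (fst x) B" "B \<in> Ob A"
    and "\<And>i. i \<in> {1..n} \<Longrightarrow> p \<cdot> snd x i = Zero A (on_ob (F i) (fst x)) B"
    and "\<And>D h. \<lbrakk>h \<in> Hom A (fst x) D; \<And>i. i \<in> {1..n} \<Longrightarrow> h \<cdot> snd x i = Zero A (on_ob (F i) (fst x)) D\<rbrakk>
      \<Longrightarrow> \<exists>u. u \<in> Hom A B D \<and> u \<cdot> p = h"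
    and "\<And>D u u'. \<lbrakk>u \<in> Hom A B D; u' \<in> Hom A B D; u \<cdot> p = u' \<cdot> p\<rbrakk> \<Longrightarrow> u = u'"
proof -
  show x: "x \<in> obs" and p: "p \<in> Hom A (fst x) B" using assms by (simp_all add: cokernel_ext_def)
  show "B \<in> Ob A" using Hom_Ob(2)[OF p] .
  show 0: "p \<cdot> snd x i = Zero A (on_ob (F i) (fst x)) B" if "i \<in> {1..n}" for i
    using assms that unfolding cokernel_ext_def by blast
  have univ: "\<exists>!u. u \<in> Hom A B D \<and> u \<cdot> p = h"
    if "h \<in> Hom A (fst x) D" "\<And>i. i \<in> {1..n} \<Longrightarrow> h \<cdot> snd x i = Zero A (on_ob (F i) (fst x)) D" for D h
    using assms that unfolding cokernel_ext_def by simp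
  show "\<exists>u. u \<in> Hom A B D \<and> u \<cdot> p = h"
    if "h \<in> Hom A (fst x) D" "\<And>i. i \<in> {1..n} \<Longrightarrow> h \<cdot> snd x i = Zero A (on_ob (F i) (fst x)) D" for D h
    using univ[OF that] by (rule ex1_implies_ex)
  show "u = u'" if u: "u \<in> Hom A B D" and u': "u' \<in> Hom A B D" and eq: "u \<cdot> p = u' \<cdot> p" for D u u'
  proof -
    \<comment> \<open>Uniqueness is available for arrows that kill the structure maps;
      \<open>u \<cdot> p\<close> does so because \<open>p\<close> does. Hence \<open>p\<close> is
      right-cancellable.\<close>
    have "(u \<cdot> p) \<cdot> snd x i = Zero A (on_ob (F i) (fst x)) D" if i: "i \<in> {1..n}" for i
      using Comp_assoc[OF obsD(2)[OF x i] p u] 0[OF i] u Hom_Ob(1)[OF obsD(2)[OF x i]]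
      by (simp add: Hom_iff)
    then have "\<exists>!v. v \<in> Hom A B D \<and> v \<cdot> p = u \<cdot> p" by (rule univ[OF Comp_Hom[OF p u]])
    then show ?thesis using u u' eq by (elim ex1E) metis
  qed
qed

text \<open>As \<open>\<gamma>\<close> intertwines the structure maps,
  \<open>p \<cdot> \<gamma>\<close> meets the structure of \<open>y\<close> only through that of
  \<open>x\<close>, which \<open>p\<close> kills.\<close>

lemma cokernel_ext_kills:
  assumes p: "cokernel_ext x B p" and y: "y \<in> obs" and \<gamma>: "\<gamma> \<in> mor y x" and i: "i \<in> {1..n}"
  shows "(p \<cdot> \<gamma>) \<cdot> snd y i = Zero A (on_ob (F i) (fst y)) B"
proof -
  note P = cokernel_extD[OF p] and g = hom_Hom[OF \<gamma>]
  have "(p \<cdot> \<gamma>) \<cdot> snd y i = p \<cdot> snd x i \<cdot> on_ar (F i) \<gamma>"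
    using Comp_assoc[OF obsD(2)[OF y i] g P(2)] hom_eq[OF \<gamma> i] by simp
  also have "\<dots> = (p \<cdot> snd x i) \<cdot> on_ar (F i) \<gamma>"
    using Comp_assoc[OF F_Hom[OF i g] obsD(2)[OF P(1) i] P(2)] by simp
  also have "\<dots> = Zero A (on_ob (F i) (fst y)) B"
    using P(4)[OF i] F_Hom[OF i g] P(3) by (simp add: Hom_iff)
  finally show ?thesis .
qed

text \<open>The arrow \<open>c\<close> is C(\<gamma>). Only its existence is recorded; uniqueness is
  the cancellation property of \<open>p\<close>.\<close>

lemma cokernel_ext_map:
  assumes p: "cokernel_ext x B p" and q: "cokernel_ext y D q" and \<gamma>: "\<gamma> \<in> mor x y"
  obtains c where "c \<in> Hom A B D" "c \<cdot> p = q \<cdot> \<gamma>"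
  using cokernel_extD(5)[OF p Comp_Hom[OF hom_Hom[OF \<gamma>] cokernel_extD(2)[OF q]]]
    cokernel_ext_kills[OF q cokernel_extD(1)[OF p] \<gamma>] by blast

section \<open>Zero structures, and preservation of coproducts by C and T\<close>

lemma zero_ext_obs:
  assumes "D \<in> Ob A"
  shows "(D, \<lambda>i \<in> {1..n}. Zero A (on_ob (F i) D) D) \<in> obs"
  using assms by (auto simp: ext_obs_def Zero_Hom F_Zero)

lemma mor_zero_ext_iff:
  assumes x: "x \<in> obs" and D: "D \<in> Ob A"
  shows "h \<in> mor x (D, \<lambda>i \<in> {1..n}. Zero A (on_ob (F i) D) D) \<longleftrightarrow>
    h \<in> Hom A (fst x) D \<and> (\<forall>i \<in> {1..n}. h \<cdot> snd x i = Zero A (on_ob (F i) (fst x)) D)"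
  using D unfolding ext_hom_iff by (intro conj_cong ball_cong) (auto simp: Hom_iff)

text \<open>Arrows from \<open>D\<close> to V correspond to morphisms from \<open>w\<close> to
  (V,0), these to families of morphisms from the \<open>x j\<close> to (V,0), and these to families
  of arrows from the \<open>B j\<close> to V.\<close>

lemma cokernel_ext_coproduct:
  assumes cop: "is_coproduct E J x \<iota> w" and p: "\<And>j. j \<in> J \<Longrightarrow> cokernel_ext (x j) (B j) (p j)"
    and q: "cokernel_ext w D q"
  obtains c where "is_coproduct A J B c D"
proof -
  obtain \<gamma> where w: "w \<in> obs" and x: "\<forall>j \<in> J. x j \<in> obs" and \<gamma>: "\<forall>j \<in> J. \<gamma> j \<in> mor (x j) w"
    and univ: "\<forall>v \<in> obs. \<forall>g. (\<forall>j \<in> J. g j \<in> mor (x j) v) \<longrightarrow>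
      (\<exists>!h. h \<in> mor w v \<and> (\<forall>j \<in> J. h \<cdot> \<gamma> j = g j))"
    using cop by (rule coproduct_E_D)
  have "\<exists>c. \<forall>j \<in> J. c j \<in> Hom A (B j) D \<and> c j \<cdot> p j = q \<cdot> \<gamma> j"
    using cokernel_ext_map[OF p q] \<gamma> by (intro bchoice ballI) metis
  then obtain c where c: "\<And>j. j \<in> J \<Longrightarrow> c j \<in> Hom A (B j) D" "\<And>j. j \<in> J \<Longrightarrow> c j \<cdot> p j = q \<cdot> \<gamma> j"
    by blast
  have "is_coproduct A J B c D"
    unfolding is_coproduct_def
  proof (intro conjI ballI allI impI)
    show "D \<in> Ob A" by (rule cokernel_extD(3)[OF q])
    show "c j \<in> Hom A (B j) D" if "j \<in> J" for j using c(1)[OF that] .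
    fix V f assume V: "V \<in> Ob A" and f: "\<forall>j \<in> J. f j \<in> Hom A (B j) V"
    let ?V = "(V, \<lambda>i \<in> {1..n}. Zero A (on_ob (F i) V) V)"
    \<comment> \<open>Transposing the family: an arrow out of \<open>B j\<close> becomes a morphism
      from \<open>x j\<close> to V with zero structure.\<close>
    have fp: "f j \<cdot> p j \<in> mor (x j) ?V" if j: "j \<in> J" for j
    proof -
      note P = cokernel_extD[OF p[OF j]] and fj = bspec[OF f j]
      have "(f j \<cdot> p j) \<cdot> snd (x j) i = Zero A (on_ob (F i) (fst (x j))) V" if i: "i \<in> {1..n}" for i
        using Comp_assoc[OF obsD(2)[OF P(1) i] P(2) fj] P(4)[OF i] fj
          Hom_Ob(1)[OF obsD(2)[OF P(1) i]] by (simp add: Hom_iff)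
      then show ?thesis using Comp_Hom[OF P(2) fj] mor_zero_ext_iff[OF P(1) V] by simp
    qed
    have univV: "\<exists>!h. h \<in> mor w ?V \<and> (\<forall>j \<in> J. h \<cdot> \<gamma> j = f j \<cdot> p j)"
      using univ[rule_format, OF zero_ext_obs[OF V], of "\<lambda>j. f j \<cdot> p j"] fp by simp
    from ex1_implies_ex[OF univV] obtain h
      where h: "h \<in> mor w ?V" "\<forall>j \<in> J. h \<cdot> \<gamma> j = f j \<cdot> p j" by blast
    obtain u where u: "u \<in> Hom A D V" "u \<cdot> q = h"
      using cokernel_extD(5)[OF q, of h V] h(1)[unfolded mor_zero_ext_iff[OF w V]] by blast
    \<comment> \<open>Any solution \<open>u'\<close> on \<open>D\<close> transposes to a solution of
      the transposed problem on \<open>w\<close>; this carries uniqueness over from \<open>w\<close>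
      to \<open>D\<close>.\<close>
    have char: "u' \<cdot> q \<in> mor w ?V \<and> (\<forall>j \<in> J. (u' \<cdot> q) \<cdot> \<gamma> j = f j \<cdot> p j)"
      if u': "u' \<in> Hom A D V" "\<forall>j \<in> J. u' \<cdot> c j = f j" for u'
    proof
      have "(u' \<cdot> q) \<cdot> snd w i = Zero A (on_ob (F i) (fst w)) V" if i: "i \<in> {1..n}" for i
        using Comp_assoc[OF obsD(2)[OF w i] cokernel_extD(2)[OF q] u'(1)]
          cokernel_extD(4)[OF q i] u'(1)
          Hom_Ob(1)[OF obsD(2)[OF w i]] by (simp add: Hom_iff)
      then show "u' \<cdot> q \<in> mor w ?V"
        using Comp_Hom[OF cokernel_extD(2)[OF q] u'(1)] mor_zero_ext_iff[OF w V] by simp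
      show "\<forall>j \<in> J. (u' \<cdot> q) \<cdot> \<gamma> j = f j \<cdot> p j"
      proof
        fix j assume j: "j \<in> J"
        have "(u' \<cdot> q) \<cdot> \<gamma> j = u' \<cdot> c j \<cdot> p j"
          using Comp_assoc[OF hom_Hom[OF bspec[OF \<gamma> j]] cokernel_extD(2)[OF q] u'(1)] c(2)[OF j]
            by simp
        also have "\<dots> = f j \<cdot> p j"
          using Comp_assoc[OF cokernel_extD(2)[OF p[OF j]] c(1)[OF j] u'(1)] u'(2) j by simp
        finally show "(u' \<cdot> q) \<cdot> \<gamma> j = f j \<cdot> p j" .
      qed
    qed
    show "\<exists>!h. h \<in> Hom A D V \<and> (\<forall>j \<in> J. h \<cdot> c j = f j)"
    proof (rule ex1I[of _ u])
      have "u \<cdot> c j = f j" if j: "j \<in> J" for j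
      proof (rule cokernel_extD(6)[OF p[OF j]])
        show "u \<cdot> c j \<in> Hom A (B j) V" "f j \<in> Hom A (B j) V"
          using Comp_Hom[OF c(1)[OF j] u(1)] bspec[OF f j] .
        have "(u \<cdot> c j) \<cdot> p j = u \<cdot> q \<cdot> \<gamma> j"
          using Comp_assoc[OF cokernel_extD(2)[OF p[OF j]] c(1)[OF j] u(1)] c(2)[OF j] by simp
        also have "\<dots> = f j \<cdot> p j"
          using Comp_assoc[OF hom_Hom[OF bspec[OF \<gamma> j]] cokernel_extD(2)[OF q] u(1)] u(2) h(2) j
            by simp
        finally show "(u \<cdot> c j) \<cdot> p j = f j \<cdot> p j" .
      qed
      then show "u \<in> Hom A D V \<and> (\<forall>j \<in> J. u \<cdot> c j = f j)" using u(1) by blast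
      fix u' assume u': "u' \<in> Hom A D V \<and> (\<forall>j \<in> J. u' \<cdot> c j = f j)"
      have "u' \<cdot> q = h" using univV char[of u'] u' h by metis
      then show "u' = u" using cokernel_extD(6)[OF q] u u' by blast
    qed
  qed
  then show ?thesis by (rule that)
qed

text \<open>Morphisms from \<open>w\<close> to v correspond to arrows from \<open>W\<close> to
  \<open>fst v\<close>, these to families of arrows from the \<open>Z j\<close>, and these to
  families of morphisms from the \<open>x j\<close>. Here \<open>w\<close> and the
  \<open>x j\<close> may be any free objects, not just values of \<open>T_ob\<close>.\<close>

lemma free_ext_coproduct:
  assumes cop: "is_coproduct A J Z c W" and x: "\<And>j. j \<in> J \<Longrightarrow> free_ext (x j) (Z j) (\<eta> j)"
    and w: "free_ext w W \<theta>"
  obtains \<iota> where "is_coproduct E J x \<iota> w"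
proof -
  note wD = free_extD[OF w]
  have c: "\<And>j. j \<in> J \<Longrightarrow> c j \<in> Hom A (Z j) W"
    and univ: "\<And>V f. V \<in> Ob A \<Longrightarrow> (\<And>j. j \<in> J \<Longrightarrow> f j \<in> Hom A (Z j) V) \<Longrightarrow>
      \<exists>!h. h \<in> Hom A W V \<and> (\<forall>j \<in> J. h \<cdot> c j = f j)"
    using cop coproduct_universal[OF cop] by (simp_all add: is_coproduct_def)
  have "\<exists>\<gamma>. \<forall>j \<in> J. \<gamma> j \<in> mor (x j) w \<and> \<gamma> j \<cdot> \<eta> j = \<theta> \<cdot> c j"
    using free_extD(4)[OF x wD(1)] Comp_Hom[OF c wD(2)] by (intro bchoice ballI) blast
  then obtain \<gamma> where \<gamma>: "\<And>j. j \<in> J \<Longrightarrow> \<gamma> j \<in> mor (x j) w" "\<And>j. j \<in> J \<Longrightarrow> \<gamma> j \<cdot> \<eta> j = \<theta> \<cdot> c j"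
    by blast
  \<comment> \<open>Naturality of the transposition: restricting \<open>h\<close> to the summand
    \<open>x j\<close> corresponds to restricting its transpose \<open>h \<cdot> \<theta>\<close>
    along \<open>c j\<close>.\<close>
  have shift: "(h \<cdot> \<theta>) \<cdot> c j = (h \<cdot> \<gamma> j) \<cdot> \<eta> j" if j: "j \<in> J" and h: "h \<in> mor w v" for j v h
    using Comp_assoc[OF c[OF j] wD(2) hom_Hom[OF h]] \<gamma>(2)[OF j]
      Comp_assoc[OF free_extD(2)[OF x[OF j]] hom_Hom[OF \<gamma>(1)[OF j]] hom_Hom[OF h]] by simp
  have "is_coproduct E J x (\<lambda>j. (x j, w, \<gamma> j)) w"
  proof (rule coproduct_E_I)
    show "w \<in> obs" by (rule wD(1))
    show "x j \<in> obs" if "j \<in> J" for j using free_extD(1)[OF x[OF that]] .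
    show "\<gamma> j \<in> mor (x j) w" if "j \<in> J" for j using \<gamma>(1)[OF that] .
    fix v g assume v: "v \<in> obs" and g: "\<And>j. j \<in> J \<Longrightarrow> g j \<in> mor (x j) v"
    have g\<eta>: "g j \<cdot> \<eta> j \<in> Hom A (Z j) (fst v)" if "j \<in> J" for j
      using Comp_Hom[OF free_extD(2)[OF x[OF that]] hom_Hom[OF g[OF that]]] .
    have univV: "\<exists>!h. h \<in> Hom A W (fst v) \<and> (\<forall>j \<in> J. h \<cdot> c j = g j \<cdot> \<eta> j)"
      using obsD(1)[OF v] g\<eta> by (rule univ)
    from ex1_implies_ex[OF univV] obtain k
      where k: "k \<in> Hom A W (fst v)" "\<forall>j \<in> J. k \<cdot> c j = g j \<cdot> \<eta> j" by blast
    obtain h where h: "h \<in> mor w v" "h \<cdot> \<theta> = k" using wD(4)[OF v k(1)] by blast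
    show "\<exists>!h. h \<in> mor w v \<and> (\<forall>j \<in> J. h \<cdot> \<gamma> j = g j)"
    proof (rule ex1I[of _ h])
      have "h \<cdot> \<gamma> j = g j" if j: "j \<in> J" for j
      proof (rule free_extD(5)[OF x[OF j] v])
        show "h \<cdot> \<gamma> j \<in> mor (x j) v"
          using hom_Comp[OF free_extD(1)[OF x[OF j]] wD(1) v \<gamma>(1)[OF j] h(1)] .
        show "g j \<in> mor (x j) v" using g[OF j] .
        show "(h \<cdot> \<gamma> j) \<cdot> \<eta> j = g j \<cdot> \<eta> j" using shift[OF j h(1)] h(2) k(2) j by simp
      qed
      then show "h \<in> mor w v \<and> (\<forall>j \<in> J. h \<cdot> \<gamma> j = g j)" using h(1) by blast
      fix h' assume h': "h' \<in> mor w v \<and> (\<forall>j \<in> J. h' \<cdot> \<gamma> j = g j)"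
      have "h' \<cdot> \<theta> \<in> Hom A W (fst v) \<and> (\<forall>j \<in> J. (h' \<cdot> \<theta>) \<cdot> c j = g j \<cdot> \<eta> j)"
        using shift[OF _ conjunct1[OF h']] h' Comp_Hom[OF wD(2) hom_Hom[OF conjunct1[OF h']]]
          by simp
      then have "h' \<cdot> \<theta> = h \<cdot> \<theta>" using univV h(2) k by metis
      then show "h' = h" using wD(5)[OF v] h' h(1) by blast
    qed
  qed
  then show ?thesis by (rule that)
qed

text \<open>Precomposition with the isomorphism matches the two universal properties. This turns
  \<open>x\<close> \<cong> T(B) into freeness of \<open>x\<close> itself on B, so that
  \<open>x\<close> can occur literally as a summand of a coproduct.\<close>

lemma free_ext_iso:
  assumes x: "free_ext x Z \<eta>" and y: "y \<in> obs" and \<phi>: "\<phi> \<in> mor x y" and \<psi>: "\<psi> \<in> mor y x"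
    and inv: "\<psi> \<cdot> \<phi> = Ide A (fst x)" "\<phi> \<cdot> \<psi> = Ide A (fst y)"
  shows "free_ext y Z (\<phi> \<cdot> \<eta>)"
  unfolding free_ext_def
proof (intro conjI ballI)
  note X = free_extD[OF x] and \<phi>' = hom_Hom[OF \<phi>] and \<psi>' = hom_Hom[OF \<psi>]
  show "y \<in> obs" by fact
  show "\<phi> \<cdot> \<eta> \<in> Hom A Z (fst y)" using Comp_Hom[OF X(2) \<phi>'] .
  fix z g assume z: "z \<in> obs" and g: "g \<in> Hom A Z (fst z)"
  obtain h where h: "h \<in> mor x z" "h \<cdot> \<eta> = g" using X(4)[OF z g] by blast
  show "\<exists>!h. h \<in> mor y z \<and> h \<cdot> \<phi> \<cdot> \<eta> = g"
  proof (rule ex1I[of _ "h \<cdot> \<psi>"])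
    have "(h \<cdot> \<psi>) \<cdot> \<phi> = h"
      using Comp_assoc[OF \<phi>' \<psi>' hom_Hom[OF h(1)]] inv(1) Ide_right[OF hom_Hom[OF h(1)]] by simp
    then have "(h \<cdot> \<psi>) \<cdot> \<phi> \<cdot> \<eta> = g"
      using Comp_assoc[OF X(2) \<phi>' Comp_Hom[OF \<psi>' hom_Hom[OF h(1)]]] h(2) by simp
    then show "h \<cdot> \<psi> \<in> mor y z \<and> (h \<cdot> \<psi>) \<cdot> \<phi> \<cdot> \<eta> = g" using hom_Comp[OF y X(1) z \<psi> h(1)] by simp
    fix k assume "k \<in> mor y z \<and> k \<cdot> \<phi> \<cdot> \<eta> = g"
    then have k: "k \<in> mor y z" "k \<cdot> \<phi> \<cdot> \<eta> = g" by simp_all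
    have "(k \<cdot> \<phi>) \<cdot> \<eta> = h \<cdot> \<eta>"
      using Comp_assoc[OF X(2) \<phi>' hom_Hom[OF k(1)]] k(2) h(2) by simp
    then have "k \<cdot> \<phi> = h" using X(5)[OF z hom_Comp[OF X(1) y z \<phi> k(1)] h(1)] by simp
    then show "k = h \<cdot> \<psi>"
      using Comp_assoc[OF \<psi>' \<phi>' hom_Hom[OF k(1)]] inv(2) Ide_right[OF hom_Hom[OF k(1)]] by simp
  qed
qed

section \<open>The functors T and C\<close>

lemma dsum_biproduct:
  assumes "finite (J :: nat set)" "\<And>j. j \<in> J \<Longrightarrow> X j \<in> Ob A"
  shows "is_biproduct A J X (dsum_ob A J X, dsum_inj A J X, dsum_proj A J X)"
proof -
  have "is_biproduct A J X (dsum A J X)"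
    unfolding dsum_def using finite_biproducts[OF assms] by (rule someI_ex)
  then show ?thesis by (simp add: dsum_ob_def dsum_inj_def dsum_proj_def)
qed

abbreviation "S \<equiv> T_summand F"
abbreviation "TO Z \<equiv> dsum_ob A {0..n} (S Z)"
abbreviation "TI Z \<equiv> dsum_inj A {0..n} (S Z)"
abbreviation "TP Z \<equiv> dsum_proj A {0..n} (S Z)"
abbreviation "T \<equiv> T_ob A n F \<Phi>"
abbreviation "\<kappa> \<equiv> T_map A n F \<Phi>"

text \<open>With \<open>S Z 0 = Z\<close> read as the value at \<open>Z\<close> of an identity
  functor in degree 0, this extends \<open>\<Phi> i j\<close> by the identity to
  \<open>j = 0\<close>, so that every column of \<open>\<kappa>\<close> obeys one formula.\<close>

definition \<phi> :: "nat \<Rightarrow> nat \<Rightarrow> 'o \<Rightarrow> 'm" where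
  "\<phi> i j Z = (if j = 0 then Ide A (on_ob (F i) Z) else \<Phi> i j Z)"

lemma S_Ob [simp]: "\<lbrakk>Z \<in> Ob A; j \<le> n\<rbrakk> \<Longrightarrow> S Z j \<in> Ob A"
  by (simp add: T_summand_def)

lemma T_biproduct: "Z \<in> Ob A \<Longrightarrow> is_biproduct A {0..n} (S Z) (TO Z, TI Z, TP Z)"
  by (rule dsum_biproduct) simp_all

lemma T_biproductD:
  assumes "Z \<in> Ob A"
  shows "TO Z \<in> Ob A"
    and "\<And>j. j \<le> n \<Longrightarrow> TI Z j \<in> Hom A (S Z j) (TO Z)"
    and "\<And>j. j \<le> n \<Longrightarrow> TP Z j \<in> Hom A (TO Z) (S Z j)"
    and "\<And>j k. \<lbrakk>j \<le> n; k \<le> n\<rbrakk> \<Longrightarrow>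
      TP Z k \<cdot> TI Z j = (if j = k then Ide A (S Z j) else Zero A (S Z j) (S Z k))"
    and "hom_sum A (TO Z) (TO Z) (\<lambda>j. TI Z j \<cdot> TP Z j) {0..n} = Ide A (TO Z)"
  using T_biproduct[OF assms] by (simp_all add: is_biproduct_def)

lemma T_Ar [simp]:
  assumes "Z \<in> Ob A" "j \<le> n"
  shows "TI Z j \<in> Ar A" "Source A (TI Z j) = S Z j" "Target A (TI Z j) = TO Z"
    "TP Z j \<in> Ar A" "Source A (TP Z j) = TO Z" "Target A (TP Z j) = S Z j"
  using T_biproductD(2,3)[OF assms] by (simp_all add: Hom_iff)

lemma \<phi>_Hom:
  assumes "i \<in> {1..n}" "i + j \<le> n" "Z \<in> Ob A"
  shows "\<phi> i j Z \<in> Hom A (on_ob (F i) (S Z j)) (S Z (i + j))"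
  using assms \<Phi>_Hom[of i j Z] Ide_Hom by (simp add: \<phi>_def T_summand_def)

text \<open>For \<open>k = 0\<close> both sides reduce to \<open>\<Phi> i j Z\<close>, as
  \<open>j\<close> is positive; otherwise this is the associativity of
  \<open>\<Phi>\<close>.\<close>

lemma \<phi>_assoc:
  assumes "i \<in> {1..n}" "j \<in> {1..n}" "i + j + k \<le> n" "Z \<in> Ob A"
  shows "\<phi> i (j + k) Z \<cdot> on_ar (F i) (\<phi> j k Z) = \<phi> (i + j) k Z \<cdot> \<Phi> i j (S Z k)"
proof (cases "k = 0")
  case True
  then show ?thesis using assms by (simp add: \<phi>_def T_summand_def F_Ide)
next
  case False
  then show ?thesis using assms \<Phi>_associative
    by (simp add: \<phi>_def T_summand_def associative_family_def)
qed

lemma eq_if_eq_on_TI: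
  assumes "Z \<in> Ob A" "u \<in> Hom A (TO Z) W" "v \<in> Hom A (TO Z) W"
    and "\<And>j. j \<le> n \<Longrightarrow> u \<cdot> TI Z j = v \<cdot> TI Z j"
  shows "u = v"
  by (rule eq_if_eq_on_sum_Ide[OF _ T_biproductD(2,3,5)[OF assms(1)] assms(2,3)])
    (simp_all add: assms(4))

text \<open>The images of the injections and projections under an additive functor still decompose
  the identity. The instances are the \<open>F i\<close> and composites of two of them.\<close>

lemma eq_if_eq_on_functor_TI:
  assumes G: "additive_endofunctor A G" and Z: "Z \<in> Ob A"
    and u: "u \<in> Hom A (on_ob G (TO Z)) W" "v \<in> Hom A (on_ob G (TO Z)) W"
    and eq: "\<And>j. j \<le> n \<Longrightarrow> u \<cdot> on_ar G (TI Z j) = v \<cdot> on_ar G (TI Z j)"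
  shows "u = v"
proof -
  interpret G: additive_endofunctor A G by fact
  note B = T_biproductD[OF Z]
  have sum: "hom_sum A (on_ob G (TO Z)) (on_ob G (TO Z))
    (\<lambda>j. on_ar G (TI Z j) \<cdot> on_ar G (TP Z j)) {0..n}
      = Ide A (on_ob G (TO Z))"
    by (rule G.on_ar_sum_Ide[OF _ B(2,3,5,1)]) simp_all
  show ?thesis
    by (rule eq_if_eq_on_sum_Ide[OF _ G.on_ar_Hom[OF B(2)] G.on_ar_Hom[OF B(3)] sum u])
      (simp_all add: eq)
qed

section \<open>Columns and rows of the structure maps of T(Z)\<close>

lemma T_term_Hom:
  assumes "i \<in> {1..n}" "i + k \<le> n" "Z \<in> Ob A"
  shows "TI Z (i + k) \<cdot> \<phi> i k Z \<cdot> on_ar (F i) (TP Z k) \<in> Hom A (on_ob (F i) (TO Z)) (TO Z)"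
  using assms \<phi>_Hom[OF assms] by (simp add: Hom_iff)

lemma T_map_eq:
  assumes i: "i \<in> {1..n}" and Z: "Z \<in> Ob A"
  shows "\<kappa> Z i = hom_sum A (on_ob (F i) (TO Z)) (TO Z)
    (\<lambda>k. TI Z (i + k) \<cdot> \<phi> i k Z \<cdot> on_ar (F i) (TP Z k)) {k. i + k \<le> n}"
  by (simp add: T_map_def \<phi>_def Let_def)

lemma T_map_Hom:
  assumes i: "i \<in> {1..n}" and Z: "Z \<in> Ob A"
  shows "\<kappa> Z i \<in> Hom A (on_ob (F i) (TO Z)) (TO Z)"
  unfolding T_map_eq[OF assms]
  by (rule hom_sum_Hom) (use T_term_Hom[OF i _ Z] T_biproductD(1)[OF Z] i in auto)

text \<open>\<open>F i\<close> sends the product of a projection and an injection to an identity or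
  a zero, so at most the term \<open>k = j\<close> survives, and it belongs to the sum only if
  \<open>i + j \<le> n\<close>. The later computations with \<open>\<kappa>\<close> go through this
  column formula.\<close>

lemma T_map_TI:
  assumes i: "i \<in> {1..n}" and Z: "Z \<in> Ob A" and j: "j \<le> n"
  shows "\<kappa> Z i \<cdot> on_ar (F i) (TI Z j) =
    (if i + j \<le> n then TI Z (i + j) \<cdot> \<phi> i j Z else Zero A (on_ob (F i) (S Z j)) (TO Z))"
proof -
  let ?t = "\<lambda>k. TI Z (i + k) \<cdot> \<phi> i k Z \<cdot> on_ar (F i) (TP Z k)"
  let ?u = "\<lambda>k. ?t k \<cdot> on_ar (F i) (TI Z j)"
  note B = T_biproductD[OF Z]
  have fin: "finite {k. i + k \<le> n}" by (rule finite_subset[of _ "{..n}"]) auto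
  have "\<kappa> Z i \<cdot> on_ar (F i) (TI Z j) = hom_sum A (on_ob (F i) (S Z j)) (TO Z) ?u {k. i + k \<le> n}"
    unfolding T_map_eq[OF i Z]
    by (rule hom_sum_Comp[OF B(1) F_Hom[OF i B(2)[OF j]] fin]) (use T_term_Hom[OF i _ Z] in auto)
  moreover have u: "?u k = (if k = j then TI Z (i + j) \<cdot> \<phi> i j Z
    else Zero A (on_ob (F i) (S Z j)) (TO Z))"
    if k: "i + k \<le> n" for k
  proof -
    have kn: "k \<le> n" using k by simp
    note ph = \<phi>_Hom[OF i k Z]
    have "?u k = TI Z (i + k) \<cdot> \<phi> i k Z \<cdot> on_ar (F i) (TP Z k) \<cdot> on_ar (F i) (TI Z j)"
      using i j k kn Z ph by (simp add: Hom_iff)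
    also have "on_ar (F i) (TP Z k) \<cdot> on_ar (F i) (TI Z j) = on_ar (F i) (TP Z k \<cdot> TI Z j)"
      using F_Comp[OF i B(2)[OF j] B(3)[OF kn]] by simp
    also have "\<dots> = (if k = j then Ide A (on_ob (F i) (S Z j))
      else Zero A (on_ob (F i) (S Z j)) (on_ob (F i) (S Z k)))"
      using B(4)[OF j kn] F_Ide[OF i] F_Zero[OF i] Z j kn by simp
    finally show ?thesis
      using ph i j k kn Z B(1) by (cases "k = j") (simp_all add: Hom_iff)
  qed
  ultimately show ?thesis
  proof (cases "i + j \<le> n")
    case True
    have "hom_sum A (on_ob (F i) (S Z j)) (TO Z) ?u {k. i + k \<le> n} = ?u j"
      using True Z i j B(1) fin u \<phi>_Hom[OF i True Z]
      by (intro hom_sum_single) (simp_all add: Hom_iff)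
    then show ?thesis using \<open>\<kappa> Z i \<cdot> on_ar (F i) (TI Z j) = _\<close> u[OF True] True by simp
  next
    case False
    have "hom_sum A (on_ob (F i) (S Z j)) (TO Z) ?u {k. i + k \<le> n}
      = Zero A (on_ob (F i) (S Z j)) (TO Z)"
      using False Z i j B(1) u by (intro hom_sum_Zero) auto
    then show ?thesis using \<open>\<kappa> Z i \<cdot> on_ar (F i) (TI Z j) = _\<close> False by simp
  qed
qed

lemma T_ob_simps [simp]: "fst (T Z) = TO Z" "i \<in> {1..n} \<Longrightarrow> snd (T Z) i = \<kappa> Z i"
  by (simp_all add: T_ob_def)

lemma T_map_Ar [simp]:
  assumes "i \<in> {1..n}" "Z \<in> Ob A"
  shows "\<kappa> Z i \<in> Ar A" "Source A (\<kappa> Z i) = on_ob (F i) (TO Z)" "Target A (\<kappa> Z i) = TO Z"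
  using T_map_Hom[OF assms] by (simp_all add: Hom_iff)

text \<open>Tested on the k-th summand, both sides land in degree \<open>i + j + k\<close> and agree
  there by associativity and naturality of \<open>\<Phi>\<close>, or vanish when that degree exceeds
  \<open>n\<close>. If \<open>i + j\<close> or \<open>j + k\<close> already exceeds
  \<open>n\<close>, so does the total.\<close>

lemma T_map_T_map:
  assumes i: "i \<in> {1..n}" and j: "j \<in> {1..n}" and Z: "Z \<in> Ob A"
  shows "\<kappa> Z i \<cdot> on_ar (F i) (\<kappa> Z j) = (if i + j \<le> n then \<kappa> Z (i + j) \<cdot> \<Phi> i j (TO Z)
    else Zero A (on_ob (F i) (on_ob (F j) (TO Z))) (TO Z))" (is "?l = ?r")
proof -
  let ?G = "functor_comp (F i) (F j)"
  note B = T_biproductD[OF Z]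
  have G [simp]: "on_ob ?G X = on_ob (F i) (on_ob (F j) X)"
    "on_ar ?G h = on_ar (F i) (on_ar (F j) h)" for X h
    by (simp_all add: functor_comp_def)
  show ?thesis
  proof (rule eq_if_eq_on_functor_TI[OF additive_endofunctor_comp[OF F_additive[OF i]
    F_additive[OF j]] Z])
    show l: "?l \<in> Hom A (on_ob ?G (TO Z)) (TO Z)" using i j Z by (simp add: Hom_iff)
    show r: "?r \<in> Hom A (on_ob ?G (TO Z)) (TO Z)" using i j Z B(1) by (simp add: Hom_iff)
    fix k assume k: "k \<le> n"
    note TIk = B(2)[OF k]
    have "?l \<cdot> on_ar ?G (TI Z k) = \<kappa> Z i \<cdot> on_ar (F i) (\<kappa> Z j) \<cdot> on_ar (F i) (on_ar (F j) (TI Z k))"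
      using i j k Z by simp
    also have "\<dots> = \<kappa> Z i \<cdot> on_ar (F i) (\<kappa> Z j \<cdot> on_ar (F j) (TI Z k))"
      using F_Comp[OF i F_Hom[OF j TIk] T_map_Hom[OF j Z]] by simp
    \<comment> \<open>The common value of both sides; the left side reaches it by two column
      formulas and associativity of \<open>\<phi>\<close>.\<close>
    also have "\<dots> = (if i + j + k \<le> n then TI Z (i + j + k) \<cdot> \<phi> (i + j) k Z \<cdot> \<Phi> i j (S Z k)
        else Zero A (on_ob (F i) (on_ob (F j) (S Z k))) (TO Z))"
    proof (cases "j + k \<le> n")
      case True
      note ph = \<phi>_Hom[OF j True Z]
      have "\<kappa> Z i \<cdot> on_ar (F i) (\<kappa> Z j \<cdot> on_ar (F j) (TI Z k))
          = \<kappa> Z i \<cdot> on_ar (F i) (TI Z (j + k)) \<cdot> on_ar (F i) (\<phi> j k Z)"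
        using T_map_TI[OF j Z k] True F_Comp[OF i ph B(2)[OF True]] by simp
      also have "\<dots> = (\<kappa> Z i \<cdot> on_ar (F i) (TI Z (j + k))) \<cdot> on_ar (F i) (\<phi> j k Z)"
        using i True Z ph by (simp add: Hom_iff)
      also have "\<dots> = (if i + j + k \<le> n then TI Z (i + j + k) \<cdot> \<phi> i (j + k) Z \<cdot> on_ar (F i) (\<phi> j k Z)
          else Zero A (on_ob (F i) (on_ob (F j) (S Z k))) (TO Z))"
      proof (cases "i + j + k \<le> n")
        case ijk: True
        note ph' = \<phi>_Hom[OF i ijk[unfolded add.assoc] Z]
        have "(\<kappa> Z i \<cdot> on_ar (F i) (TI Z (j + k))) = TI Z (i + j + k) \<cdot> \<phi> i (j + k) Z"
          using T_map_TI[OF i Z True] ijk by (simp add: add.assoc)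
        then show ?thesis using ijk ph ph' i Z by (simp add: Hom_iff add.assoc)
      next
        case ijk: False
        then show ?thesis
          using T_map_TI[OF i Z True] ph i j k Z B(1) by (simp add: Hom_iff add.assoc)
      qed
      finally show ?thesis using \<phi>_assoc[OF i j _ Z, of k] by simp
    next
      case False
      then show ?thesis
        using T_map_TI[OF j Z k] F_Zero[OF i] i j k Z B(1) by simp
    qed
    \<comment> \<open>The right side reaches the same value by naturality of \<open>\<Phi>\<close>
      at the injection, followed by one column formula.\<close>
    also have "\<dots> = ?r \<cdot> on_ar ?G (TI Z k)"
    proof (cases "i + j \<le> n")
      case True
      then have ij: "i + j \<in> {1..n}" using i by simp
      have "(\<kappa> Z (i + j) \<cdot> \<Phi> i j (TO Z)) \<cdot> on_ar (F i) (on_ar (F j) (TI Z k))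
          = \<kappa> Z (i + j) \<cdot> \<Phi> i j (TO Z) \<cdot> on_ar (F i) (on_ar (F j) (TI Z k))"
        using i j ij k True Z B(1) by simp
      also have "\<dots> = \<kappa> Z (i + j) \<cdot> on_ar (F (i + j)) (TI Z k) \<cdot> \<Phi> i j (S Z k)"
        using \<Phi>_nat[OF i j True TIk] by simp
      also have "\<dots> = (\<kappa> Z (i + j) \<cdot> on_ar (F (i + j)) (TI Z k)) \<cdot> \<Phi> i j (S Z k)"
        using i j ij k True Z by simp
      also have "\<dots> = (if i + j + k \<le> n then TI Z (i + j + k) \<cdot> \<phi> (i + j) k Z \<cdot> \<Phi> i j (S Z k)
          else Zero A (on_ob (F i) (on_ob (F j) (S Z k))) (TO Z))"
      proof (cases "i + j + k \<le> n")
        case ijk: True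
        then show ?thesis
          using T_map_TI[OF ij Z k] \<phi>_Hom[OF ij ijk Z] i j k True Z by (simp add: Hom_iff)
      next
        case False
        then show ?thesis using T_map_TI[OF ij Z k] i j k True Z B(1) by simp
      qed
      finally show ?thesis using True by simp
    next
      case False
      then show ?thesis using i j k Z B(1) by simp
    qed
    finally show "?l \<cdot> on_ar ?G (TI Z k) = ?r \<cdot> on_ar ?G (TI Z k)" .
  qed
qed

lemma T_obs:
  assumes Z: "Z \<in> Ob A"
  shows "T Z \<in> obs"
  using T_biproductD(1)[OF Z] T_map_Hom[OF _ Z] T_map_T_map[OF _ _ Z]
  by (auto simp: T_ob_def ext_obs_def)

text \<open>Expresses that T(Z) is generated in degree 0. This is why a morphism out of T(Z), in
  particular an endomorphism in the filtration argument, is determined by its restriction to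
  \<open>Z\<close>.\<close>

lemma T_map_TI_0:
  assumes "i \<in> {1..n}" "Z \<in> Ob A"
  shows "\<kappa> Z i \<cdot> on_ar (F i) (TI Z 0) = TI Z i"
  using T_map_TI[OF assms, of 0] assms by (simp add: \<phi>_def T_summand_def)

text \<open>Column \<open>k\<close> of \<open>\<kappa> Z i\<close> ends in degree
  \<open>i + k\<close>, so no row below \<open>i\<close> is hit, and row \<open>i\<close> only from
  \<open>k = 0\<close>. In terms of the filtration, \<open>\<kappa> Z i\<close> raises degrees by at
  least \<open>i\<close>.\<close>

lemma TP_T_map:
  assumes i: "i \<in> {1..n}" and Z: "Z \<in> Ob A" and l: "l \<le> i"
  shows "TP Z l \<cdot> \<kappa> Z i = (if l = i then on_ar (F i) (TP Z 0)
    else Zero A (on_ob (F i) (TO Z)) (S Z l))"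
    (is "?l = ?r")
proof (rule eq_if_eq_on_functor_TI[OF F_additive[OF i] Z])
  note B = T_biproductD[OF Z]
  have ln: "l \<le> n" using l i by simp
  show "?l \<in> Hom A (on_ob (F i) (TO Z)) (S Z l)" using i ln Z by (simp add: Hom_iff)
  show "?r \<in> Hom A (on_ob (F i) (TO Z)) (S Z l)"
    using i ln Z B(1) by (auto simp: Hom_iff T_summand_def)
  fix k assume k: "k \<le> n"
  have "?l \<cdot> on_ar (F i) (TI Z k) = TP Z l \<cdot> \<kappa> Z i \<cdot> on_ar (F i) (TI Z k)"
    using i k ln Z by simp
  also have "\<dots> = (if l = i \<and> k = 0 then Ide A (on_ob (F i) Z)
    else Zero A (on_ob (F i) (S Z k)) (S Z l))"
  proof (cases "i + k \<le> n")
    case True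
    have "TP Z l \<cdot> TI Z (i + k) \<cdot> \<phi> i k Z = (TP Z l \<cdot> TI Z (i + k)) \<cdot> \<phi> i k Z"
      using \<phi>_Hom[OF i True Z] ln True Z by (simp add: Hom_iff)
    also have "\<dots> = (if l = i \<and> k = 0 then Ide A (on_ob (F i) Z)
      else Zero A (on_ob (F i) (S Z k)) (S Z l))"
    proof (cases "l = i \<and> k = 0")
      case l0: True
      then show ?thesis using B(4)[OF True ln] i ln Z by (simp add: \<phi>_def T_summand_def)
    next
      case False
      then have "TP Z l \<cdot> TI Z (i + k) = Zero A (S Z (i + k)) (S Z l)"
        using B(4)[OF True ln] l by auto
      then have "(TP Z l \<cdot> TI Z (i + k)) \<cdot> \<phi> i k Z = Zero A (on_ob (F i) (S Z k)) (S Z l)"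
        using \<phi>_Hom[OF i True Z] i ln Z True by (simp add: Hom_iff)
      then show ?thesis using False by auto
    qed
    finally show ?thesis using T_map_TI[OF i Z k] True by simp
  next
    case False
    then have "\<not> (l = i \<and> k = 0)" using i by auto
    then show ?thesis using T_map_TI[OF i Z k] False i k ln Z B(1) by simp
  qed
  also have "\<dots> = ?r \<cdot> on_ar (F i) (TI Z k)"
  proof (cases "l = i")
    case True
    have "on_ar (F i) (TP Z 0) \<cdot> on_ar (F i) (TI Z k) = on_ar (F i) (TP Z 0 \<cdot> TI Z k)"
      using F_Comp[OF i B(2)[OF k] B(3)] by simp
    also have "\<dots> = (if k = 0 then Ide A (on_ob (F i) Z) else Zero A (on_ob (F i) (S Z k)) (S Z l))"
      using B(4)[OF k, of 0] i k Z True F_Ide[OF i Z] F_Zero[OF i, of "S Z k" Z]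
      by (auto simp: T_summand_def)
    finally show ?thesis using True by simp
  next
    case False
    then show ?thesis using i k ln Z B(1) by simp
  qed
  finally show "?l \<cdot> on_ar (F i) (TI Z k) = ?r \<cdot> on_ar (F i) (TI Z k)" .
qed

text \<open>Generation in degree 0 forces the value on the j-th summand to be
  \<open>snd y j \<cdot> on_ar (F j) g\<close>; the relations between the structure maps of
  \<open>y\<close> and naturality of \<open>\<Phi>\<close> make this choice a morphism.\<close>

lemma free_ext_T:
  assumes Z: "Z \<in> Ob A"
  shows "free_ext (T Z) Z (TI Z 0)"
  unfolding free_ext_def
proof (intro conjI ballI)
  note B = T_biproductD[OF Z]
  show "T Z \<in> obs" by (rule T_obs[OF Z])
  show \<eta>: "TI Z 0 \<in> Hom A Z (fst (T Z))" using B(2)[of 0] by (simp add: T_summand_def)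
  fix y g assume y: "y \<in> obs" and g: "g \<in> Hom A Z (fst y)"
  define c where "c j = (if j = 0 then g else snd y j \<cdot> on_ar (F j) g)" for j
  have c: "c j \<in> Hom A (S Z j) (fst y)" if "j \<le> n" for j
    using that g y by (auto simp: c_def T_summand_def Hom_iff)
  obtain h where h: "h \<in> Hom A (TO Z) (fst y)" "\<And>j. j \<le> n \<Longrightarrow> h \<cdot> TI Z j = c j"
    using biproduct_universal[OF T_biproduct[OF Z] _ obsD(1)[OF y], of c] c by auto
  have h_mor: "h \<in> mor (T Z) y"
  proof (rule homI)
    show "h \<in> Hom A (fst (T Z)) (fst y)" using h(1) by simp
    fix i assume i: "i \<in> {1..n}"
    note yi = obsD(2)[OF y i]
    have "h \<cdot> \<kappa> Z i = snd y i \<cdot> on_ar (F i) h"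
    proof (rule eq_if_eq_on_functor_TI[OF F_additive[OF i] Z])
      show "h \<cdot> \<kappa> Z i \<in> Hom A (on_ob (F i) (TO Z)) (fst y)"
        using Comp_Hom[OF T_map_Hom[OF i Z] h(1)] .
      show "snd y i \<cdot> on_ar (F i) h \<in> Hom A (on_ob (F i) (TO Z)) (fst y)"
        using Comp_Hom[OF F_Hom[OF i h(1)] yi] .
      fix k assume k: "k \<le> n"
      have l: "(h \<cdot> \<kappa> Z i) \<cdot> on_ar (F i) (TI Z k) =
        (if i + k \<le> n then c (i + k) \<cdot> \<phi> i k Z else Zero A (on_ob (F i) (S Z k)) (fst y))"
      proof -
        have "(h \<cdot> \<kappa> Z i) \<cdot> on_ar (F i) (TI Z k) = h \<cdot> \<kappa> Z i \<cdot> on_ar (F i) (TI Z k)"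
          using Comp_assoc[OF F_Hom[OF i B(2)[OF k]] T_map_Hom[OF i Z] h(1)] .
        then show ?thesis
          using T_map_TI[OF i Z k] h(1) h(2)[of "i + k"] i k Z
            Comp_assoc[OF \<phi>_Hom[OF i _ Z] B(2) h(1), of k] by (simp add: Hom_iff)
      qed
      have "(snd y i \<cdot> on_ar (F i) h) \<cdot> on_ar (F i) (TI Z k) = snd y i \<cdot> on_ar (F i) (c k)"
        using Comp_assoc[OF F_Hom[OF i B(2)[OF k]] F_Hom[OF i h(1)] yi] F_Comp[OF i B(2)[OF k] h(1)]
          h(2)[OF k]
        by simp
      also have "\<dots> = (if i + k \<le> n then c (i + k) \<cdot> \<phi> i k Z
        else Zero A (on_ob (F i) (S Z k)) (fst y))"
      proof (cases "k = 0")
        case True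
        then show ?thesis using i g y Z by (simp add: c_def \<phi>_def Hom_iff)
      next
        case False
        then have k': "k \<in> {1..n}" using k by simp
        note yk = obsD(2)[OF y k'] and Fg = F_Hom[OF k' g]
        have "snd y i \<cdot> on_ar (F i) (c k)
          = (snd y i \<cdot> on_ar (F i) (snd y k)) \<cdot> on_ar (F i) (on_ar (F k) g)"
          using False F_Comp[OF i Fg yk] Comp_assoc[OF F_Hom[OF i Fg] F_Hom[OF i yk] yi]
            by (simp add: c_def)
        also have "\<dots> = (if i + k \<le> n then c (i + k) \<cdot> \<phi> i k Z
          else Zero A (on_ob (F i) (S Z k)) (fst y))"
        proof (cases "i + k \<le> n")
          case True
          then have ik: "i + k \<in> {1..n}" using i by simp
          have "(snd y i \<cdot> on_ar (F i) (snd y k)) \<cdot> on_ar (F i) (on_ar (F k) g)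
              = snd y (i + k) \<cdot> \<Phi> i k (fst y) \<cdot> on_ar (F i) (on_ar (F k) g)"
            using obsD(3)[OF y i k' True]
              Comp_assoc[OF F_Hom[OF i Fg] \<Phi>_Hom[OF i k' True obsD(1)[OF y]] obsD(2)[OF y ik]]
                by simp
          also have "\<dots> = (snd y (i + k) \<cdot> on_ar (F (i + k)) g) \<cdot> \<Phi> i k Z"
            using \<Phi>_nat[OF i k' True g] Comp_assoc[OF \<Phi>_Hom[OF i k' True Z] F_Hom[OF ik g]
              obsD(2)[OF y ik]] by simp
          finally show ?thesis using True False by (simp add: c_def \<phi>_def)
        next
          case ik: False
          then show ?thesis
            using obsD(4)[OF y i k' ik] F_Hom[OF i Fg] obsD(1)[OF y] False
              by (simp add: Hom_iff T_summand_def)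
        qed
        finally show ?thesis .
      qed
      finally show "(h \<cdot> \<kappa> Z i) \<cdot> on_ar (F i) (TI Z k)
        = (snd y i \<cdot> on_ar (F i) h) \<cdot> on_ar (F i) (TI Z k)"
        using l by simp
    qed
    then show "h \<cdot> snd (T Z) i = snd y i \<cdot> on_ar (F i) h" using i by simp
  qed
  show "\<exists>!h. h \<in> mor (T Z) y \<and> h \<cdot> TI Z 0 = g"
  proof (rule ex1I[of _ h])
    show "h \<in> mor (T Z) y \<and> h \<cdot> TI Z 0 = g" using h_mor h(2)[of 0] by (simp add: c_def)
    fix k assume "k \<in> mor (T Z) y \<and> k \<cdot> TI Z 0 = g"
    then have k: "k \<in> mor (T Z) y" "k \<cdot> TI Z 0 = g" by simp_all
    have k': "k \<in> Hom A (TO Z) (fst y)" using hom_Hom[OF k(1)] by simp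
    show "k = h"
    proof (rule eq_if_eq_on_TI[OF Z k' h(1)])
      fix j assume j: "j \<le> n"
      show "k \<cdot> TI Z j = h \<cdot> TI Z j"
      proof (cases "j = 0")
        case True
        then show ?thesis using k(2) h(2)[of 0] by (simp add: c_def)
      next
        case False
        then have j': "j \<in> {1..n}" using j by simp
        note F0 = F_Hom[OF j' B(2)[of 0]]
        have "k \<cdot> TI Z j = (k \<cdot> \<kappa> Z j) \<cdot> on_ar (F j) (TI Z 0)"
          using T_map_TI_0[OF j' Z] Comp_assoc[OF F0 T_map_Hom[OF j' Z] k'] by simp
        also have "\<dots> = snd y j \<cdot> on_ar (F j) k \<cdot> on_ar (F j) (TI Z 0)"
          using hom_eq[OF k(1) j'] Comp_assoc[OF F0 F_Hom[OF j' k'] obsD(2)[OF y j']] j' by simp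
        also have "\<dots> = c j" using F_Comp[OF j' B(2)[of 0] k'] k(2) False by (simp add: c_def)
        finally show ?thesis using h(2)[OF j] by simp
      qed
    qed
  qed
qed

text \<open>An arrow that kills every \<open>\<kappa> Z j\<close> kills the injections of positive
  degree, since these factor through \<open>\<kappa> Z j\<close>; it is then determined by its
  restriction to \<open>Z\<close>. This is CT = id in the form of a universal arrow.\<close>

lemma cokernel_ext_T:
  assumes Z: "Z \<in> Ob A"
  shows "cokernel_ext (T Z) Z (TP Z 0)"
  unfolding cokernel_ext_def
proof (intro conjI ballI allI impI)
  note B = T_biproductD[OF Z]
  have \<iota>: "TI Z 0 \<in> Hom A Z (TO Z)" and \<pi>: "TP Z 0 \<in> Hom A (TO Z) Z"
    and \<pi>\<iota>: "TP Z 0 \<cdot> TI Z 0 = Ide A Z"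
    using B(2)[of 0] B(3)[of 0] B(4)[of 0 0] by (simp_all add: T_summand_def)
  show "T Z \<in> obs" by (rule T_obs[OF Z])
  show "TP Z 0 \<in> Hom A (fst (T Z)) Z" using \<pi> by simp
  show "TP Z 0 \<cdot> snd (T Z) i = Zero A (on_ob (F i) (fst (T Z))) Z" if "i \<in> {1..n}" for i
    using TP_T_map[OF that Z, of 0] that by (simp add: T_summand_def)
  fix D h assume h: "h \<in> Hom A (fst (T Z)) D"
    and h0: "\<forall>i \<in> {1..n}. h \<cdot> snd (T Z) i = Zero A (on_ob (F i) (fst (T Z))) D"
  have h': "h \<in> Hom A (TO Z) D" using h by simp
  have D: "D \<in> Ob A" using Hom_Ob(2)[OF h] .
  have eq: "(h \<cdot> TI Z 0) \<cdot> TP Z 0 = h"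
  proof (rule eq_if_eq_on_TI[OF Z Comp_Hom[OF \<pi> Comp_Hom[OF \<iota> h']] h'])
    fix j assume j: "j \<le> n"
    have "((h \<cdot> TI Z 0) \<cdot> TP Z 0) \<cdot> TI Z j = (h \<cdot> TI Z 0) \<cdot> TP Z 0 \<cdot> TI Z j"
      using Comp_assoc[OF B(2)[OF j] \<pi> Comp_Hom[OF \<iota> h']] .
    also have "\<dots> = h \<cdot> TI Z j"
    proof (cases "j = 0")
      case True
      then show ?thesis using \<pi>\<iota> Ide_right[OF Comp_Hom[OF \<iota> h']] by simp
    next
      case False
      then have j': "j \<in> {1..n}" using j by simp
      note F0 = F_Hom[OF j' \<iota>]
      have "h \<cdot> TI Z j = (h \<cdot> \<kappa> Z j) \<cdot> on_ar (F j) (TI Z 0)"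
        using T_map_TI_0[OF j' Z] Comp_assoc[OF F0 T_map_Hom[OF j' Z] h'] by simp
      also have "\<dots> = Zero A (S Z j) D"
        using bspec[OF h0 j'] j' F0 D False by (simp add: Hom_iff T_summand_def)
      also have "\<dots> = (h \<cdot> TI Z 0) \<cdot> TP Z 0 \<cdot> TI Z j"
        using B(4)[OF j, of 0] False j Z Comp_Hom[OF \<iota> h'] by (simp add: Hom_iff T_summand_def)
      finally show ?thesis by simp
    qed
    finally show "((h \<cdot> TI Z 0) \<cdot> TP Z 0) \<cdot> TI Z j = h \<cdot> TI Z j" .
  qed
  show "\<exists>!u. u \<in> Hom A Z D \<and> u \<cdot> TP Z 0 = h"
  proof (rule ex1I[of _ "h \<cdot> TI Z 0"])
    show "h \<cdot> TI Z 0 \<in> Hom A Z D \<and> (h \<cdot> TI Z 0) \<cdot> TP Z 0 = h" using Comp_Hom[OF \<iota> h'] eq by simp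
    fix u assume u: "u \<in> Hom A Z D \<and> u \<cdot> TP Z 0 = h"
    then have "h \<cdot> TI Z 0 = u \<cdot> TP Z 0 \<cdot> TI Z 0" using Comp_assoc[OF \<iota> \<pi>, of u D] by auto
    then show "u = h \<cdot> TI Z 0" using \<pi>\<iota> Ide_right[of u Z D] u by simp
  qed
qed

text \<open>Connects the chosen cokernel with the universal arrow: killing the combined map
  \<open>s\<close> amounts to killing each \<open>snd x i = s \<cdot> \<iota> i\<close>, because the
  injections are jointly epic.\<close>

lemma C_ob_cokernel_ext:
  assumes x: "x \<in> obs"
  obtains p where "cokernel_ext x (C_ob A n F x) p"
proof -
  let ?X = "\<lambda>i. on_ob (F i) (fst x)"
  define Y where "Y = dsum_ob A {1..n} ?X"
  define \<iota> where "\<iota> = dsum_inj A {1..n} ?X"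
  define \<pi> where "\<pi> = dsum_proj A {1..n} ?X"
  define s where "s = hom_sum A Y (fst x) (\<lambda>i. snd x i \<cdot> \<pi> i) {1..n}"
  define q where "q = (SOME q. is_cokernel A s q)"
  note X = obsD(1)[OF x]
  have B: "is_biproduct A {1..n} ?X (Y, \<iota>, \<pi>)"
    unfolding Y_def \<iota>_def \<pi>_def using X by (intro dsum_biproduct) simp_all
  then have Y: "Y \<in> Ob A" and \<iota>: "\<And>i. i \<in> {1..n} \<Longrightarrow> \<iota> i \<in> Hom A (?X i) Y"
    and \<pi>: "\<And>i. i \<in> {1..n} \<Longrightarrow> \<pi> i \<in> Hom A Y (?X i)"
    and sum: "hom_sum A Y Y (\<lambda>i. \<iota> i \<cdot> \<pi> i) {1..n} = Ide A Y"
    by (simp_all add: is_biproduct_def)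
  have s: "s \<in> Hom A Y (fst x)" "\<And>i. i \<in> {1..n} \<Longrightarrow> s \<cdot> \<iota> i = snd x i"
    unfolding s_def using biproduct_universal[OF B _ X, of "snd x"] obsD(2)[OF x] by simp_all
  have C: "C_ob A n F x = Target A q"
    by (simp add: C_ob_def split_beta coker_ob_def q_def s_def Y_def \<pi>_def)
  have s': "Source A s = Y" "Target A s = fst x" "s \<in> Ar A" using s(1) by (simp_all add: Hom_iff)
  have "is_cokernel A s q" unfolding q_def using has_cokernel[OF s'(3)] by (rule someI_ex)
  then have q: "q \<in> Ar A" "Source A q = fst x" "q \<cdot> s = Zero A Y (Target A q)"
    and univ: "\<And>W h. \<lbrakk>W \<in> Ob A; h \<in> Hom A (fst x) W; h \<cdot> s = Zero A Y W\<rbrakk> \<Longrightarrow>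
      \<exists>!u. u \<in> Hom A (Target A q) W \<and> u \<cdot> q = h"
    unfolding is_cokernel_def s' by blast+
  have q': "q \<in> Hom A (fst x) (Target A q)" using q by (simp add: Hom_iff)
  have iff: "h \<cdot> s = Zero A Y D \<longleftrightarrow> (\<forall>i \<in> {1..n}. h \<cdot> snd x i = Zero A (?X i) D)"
    if h: "h \<in> Hom A (fst x) D" for h D
  proof
    note D = Hom_Ob(2)[OF h]
    have \<iota>i: "(h \<cdot> s) \<cdot> \<iota> i = h \<cdot> snd x i" if "i \<in> {1..n}" for i
      using Comp_assoc[OF \<iota>[OF that] s(1) h] s(2)[OF that] by simp
    have Z\<iota>: "Zero A Y D \<cdot> \<iota> i = Zero A (?X i) D" if "i \<in> {1..n}" for i
      using \<iota>[OF that] D by (simp add: Hom_iff)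
    show "\<forall>i \<in> {1..n}. h \<cdot> snd x i = Zero A (?X i) D" if "h \<cdot> s = Zero A Y D"
      using \<iota>i Z\<iota> that by simp
    show "h \<cdot> s = Zero A Y D" if 0: "\<forall>i \<in> {1..n}. h \<cdot> snd x i = Zero A (?X i) D"
      by (rule eq_if_eq_on_sum_Ide[OF _ \<iota> \<pi> sum Comp_Hom[OF s(1) h] Zero_Hom[OF Y D]])
        (use \<iota>i Z\<iota> 0 in auto)
  qed
  have "cokernel_ext x (Target A q) q"
    unfolding cokernel_ext_def
  proof (intro conjI allI ballI impI)
    show "q \<cdot> snd x i = Zero A (?X i) (Target A q)" if "i \<in> {1..n}" for i
      using q(3) that unfolding iff[OF q'] by blast
    show "\<exists>!u. u \<in> Hom A (Target A q) D \<and> u \<cdot> q = h"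
      if "h \<in> Hom A (fst x) D" "\<forall>i \<in> {1..n}. h \<cdot> snd x i = Zero A (?X i) D" for D h
      using univ[OF Hom_Ob(2)[OF that(1)] that(1)] that(2) unfolding iff[OF that(1)] by blast
  qed (fact x q')+
  then show ?thesis using that C by simp
qed

section \<open>Endomorphisms inducing the identity on the cokernel\<close>

text \<open>For \<open>M = 1 - u\<close> the condition \<open>p \<cdot> u = p\<close> reads
  \<open>p \<cdot> M = 0\<close>. The endomorphism \<open>N = i \<cdot> M \<cdot> r\<close> of T(Z)
  satisfies \<open>N \<cdot> i = i \<cdot> M\<close>, so strict triangularity of \<open>N\<close>
  makes \<open>M\<close> nilpotent, and the geometric series inverts \<open>u\<close>.\<close>

lemma retract_of_T_unipotent_iso:
  assumes p: "cokernel_ext x B p" and Z: "Z \<in> Ob A" and i: "i \<in> mor x (T Z)"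
    and r: "r \<in> mor (T Z) x"
    and ri: "r \<cdot> i = Ide A (fst x)" and u: "u \<in> mor x x" and pu: "p \<cdot> u = p"
  obtains v where "v \<in> mor x x" "v \<cdot> u = Ide A (fst x)" "u \<cdot> v = Ide A (fst x)"
proof -
  note P = cokernel_extD[OF p] and B = T_biproductD[OF Z] and TZ = T_obs[OF Z]
  note x = P(1) and X = obsD(1)[OF P(1)] and u' = hom_Hom[OF u]
  have i': "i \<in> Hom A (fst x) (TO Z)" and r': "r \<in> Hom A (TO Z) (fst x)"
    using hom_Hom[OF i] hom_Hom[OF r] by simp_all
  have \<pi>: "TP Z 0 \<in> Hom A (TO Z) Z" using B(3)[of 0] by (simp add: T_summand_def)
  obtain M where M: "M \<in> Hom A (fst x) (fst x)" and uM: "Plus A u M = Ide A (fst x)"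
    using Plus_complement[OF u' Ide_Hom[OF X]] by blast
  have M_mor: "M \<in> mor x x" using hom_complement[OF x x u M] uM hom_Ide[OF x] by simp
  have pM: "p \<cdot> M = Zero A (fst x) B"
  proof -
    have "Plus A p (p \<cdot> M) = p \<cdot> Plus A u M" using Comp_Plus_right[OF u' M P(2)] pu by simp
    also have "\<dots> = Plus A p (Zero A (fst x) B)"
      using uM Ide_right[OF P(2)] Plus_Zero(1)[OF P(2)] by simp
    finally show ?thesis using Plus_cancel[OF P(2) Comp_Hom[OF M P(2)] Zero_Hom[OF X P(3)]] by simp
  qed
  define N where "N = i \<cdot> M \<cdot> r"
  have N_mor: "N \<in> mor (T Z) (T Z)"
    unfolding N_def by (intro hom_Comp[OF TZ x TZ _ i] hom_Comp[OF TZ x x r M_mor])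
  have N: "N \<in> Hom A (TO Z) (TO Z)" using hom_Hom[OF N_mor] by simp
  have Ni: "N \<cdot> i = i \<cdot> M"
    using i' r' M ri by (simp add: N_def Hom_iff)
  \<comment> \<open>The degree 0 projection, restricted along \<open>i\<close>, factors through
    \<open>p\<close> by \<open>w\<close>, which is C(i), and \<open>p \<cdot> M\<close> is
    zero.\<close>
  have \<pi>N: "TP Z 0 \<cdot> N = Zero A (TO Z) Z"
  proof -
    obtain w where w: "w \<in> Hom A B Z" "w \<cdot> p = TP Z 0 \<cdot> i"
      using cokernel_ext_map[OF p cokernel_ext_T[OF Z] i] by blast
    have "TP Z 0 \<cdot> N = (TP Z 0 \<cdot> i) \<cdot> M \<cdot> r" using i' r' M Z by (simp add: N_def Hom_iff)
    also have "\<dots> = w \<cdot> (p \<cdot> M) \<cdot> r" using w P(2) r' M by (simp add: w(2)[symmetric] Hom_iff)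
    also have "\<dots> = Zero A (TO Z) Z" using pM w(1) r' P(3) B(1) by (simp add: Hom_iff)
    finally show ?thesis .
  qed
  \<comment> \<open>Strict triangularity: since \<open>N\<close> is a morphism and the j-th summand
    is generated from degree 0, the j-th column of \<open>N\<close> is \<open>\<kappa> Z j\<close>
    after \<open>F j\<close> of \<open>N \<cdot> TI Z 0\<close>, which has no part in degree
    0.\<close>
  have N_low: "(TP Z l \<cdot> N) \<cdot> TI Z j = Zero A (S Z j) (S Z l)" if l: "l \<le> j" and j: "j \<le> n" for l j
  proof (cases "j = 0")
    case True
    then show ?thesis using l \<pi>N Z B(1) by (simp add: T_summand_def)
  next
    case False
    then have j': "j \<in> {1..n}" using j by simp
    have ln: "l \<le> n" using l j by simp
    have \<iota>0: "TI Z 0 \<in> Hom A Z (TO Z)" using B(2)[of 0] by (simp add: T_summand_def)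
    note F0 = F_Hom[OF j' \<iota>0]
    have "(TP Z l \<cdot> N) \<cdot> TI Z j = TP Z l \<cdot> (N \<cdot> \<kappa> Z j) \<cdot> on_ar (F j) (TI Z 0)"
      using T_map_TI_0[OF j' Z, symmetric] N j' ln Z F0 by (simp add: Hom_iff)
    also have "N \<cdot> \<kappa> Z j = \<kappa> Z j \<cdot> on_ar (F j) N" using hom_eq[OF N_mor j'] j' by simp
    also have "TP Z l \<cdot> (\<kappa> Z j \<cdot> on_ar (F j) N) \<cdot> on_ar (F j) (TI Z 0)
        = (TP Z l \<cdot> \<kappa> Z j) \<cdot> on_ar (F j) N \<cdot> on_ar (F j) (TI Z 0)"
      using N j' ln Z F0 by (simp add: Hom_iff)
    also have "\<dots> = Zero A (S Z j) (S Z l)"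
    \<comment> \<open>On the diagonal \<open>\<kappa> Z j\<close> contributes
      \<open>on_ar (F j) (TP Z 0)\<close>, which annihilates \<open>on_ar (F j) N\<close>; for
      \<open>l < j\<close> the row of \<open>\<kappa> Z j\<close> is already zero.\<close>
    proof (cases "l = j")
      case True
      have "on_ar (F j) (TP Z 0) \<cdot> on_ar (F j) N = Zero A (on_ob (F j) (TO Z)) (on_ob (F j) Z)"
        using F_Comp[OF j' N \<pi>] \<pi>N F_Zero[OF j' B(1) Z] by simp
      moreover have "on_ar (F j) (TP Z 0) \<cdot> on_ar (F j) N \<cdot> on_ar (F j) (TI Z 0)
          = (on_ar (F j) (TP Z 0) \<cdot> on_ar (F j) N) \<cdot> on_ar (F j) (TI Z 0)"
        using Comp_assoc[OF F0 F_Hom[OF j' N] F_Hom[OF j' \<pi>]] by simp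
      ultimately show ?thesis
        using True TP_T_map[OF j' Z l] F0 j' Z False by (simp add: Hom_iff T_summand_def)
    next
      case lj: False
      then show ?thesis
        using TP_T_map[OF j' Z l] F0 F_Hom[OF j' N] j' ln Z False
          by (simp add: Hom_iff T_summand_def)
    qed
    finally show ?thesis .
  qed
  define pw where "pw k = ((\<cdot>) M ^^ k) (Ide A (fst x))" for k
  have pw_Suc: "pw (Suc k) = M \<cdot> pw k" for k by (simp add: pw_def)
  have pw: "pw k \<in> Hom A (fst x) (fst x)" for k
    by (induction k) (use M X in \<open>auto simp: pw_def Hom_iff\<close>)
  \<comment> \<open>\<open>N\<close> strictly raises the filtration of \<open>T Z\<close> by its last summands.\<close>
  have filtration: "TP Z l \<cdot> i \<cdot> pw m = Zero A (fst x) (S Z l)" if "l < m" "l \<le> n" for l m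
    using that
  proof (induction m arbitrary: l)
    case 0
    then show ?case by simp
  next
    case (Suc m)
    have "TP Z l \<cdot> i \<cdot> pw (Suc m) = TP Z l \<cdot> (i \<cdot> M) \<cdot> pw m"
      using Suc.prems i' M pw[of m] Z by (simp add: pw_Suc Hom_iff)
    also have "\<dots> = (TP Z l \<cdot> N) \<cdot> i \<cdot> pw m"
      using Suc.prems i' N pw[of m] Z by (simp add: Ni[symmetric] Hom_iff)
    also have "\<dots> = Zero A (fst x) (S Z l)"
    proof (rule Comp_eq_Zero_if_sum_Ide[OF _ B(2,3,5)])
      show "i \<cdot> pw m \<in> Hom A (fst x) (TO Z)" using Comp_Hom[OF pw i'] .
      show "TP Z l \<cdot> N \<in> Hom A (TO Z) (S Z l)" using Comp_Hom[OF N B(3)] Suc.prems by simp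
      fix j assume "j \<in> {0..n}"
      then have j: "j \<le> n" by simp
      \<comment> \<open>Since \<open>l \<le> m\<close>, the first factor vanishes for
        \<open>j \<ge> m\<close>, while the induction hypothesis kills the second for
        \<open>j < m\<close>.\<close>
      show "(TP Z l \<cdot> N) \<cdot> TI Z j = Zero A (S Z j) (S Z l) \<or> TP Z j \<cdot> i \<cdot> pw m
        = Zero A (fst x) (S Z j)"
        using N_low[of l j] Suc.IH[of j] Suc.prems j by (cases "j < m") auto
    qed simp_all
    finally show ?case .
  qed
  \<comment> \<open>The exponent is \<open>n + 1\<close> because the degrees of T(Z) are 0, ..., n:
    only then is every projection covered by \<open>filtration\<close>.\<close>
  have "Ide A (TO Z) \<cdot> i \<cdot> pw (Suc n) = Zero A (fst x) (TO Z)"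
    by (rule Comp_eq_Zero_if_sum_Ide[OF _ B(2,3,5) Comp_Hom[OF pw i'] Ide_Hom[OF B(1)]])
      (simp_all add: filtration)
  then have "i \<cdot> pw (Suc n) = Zero A (fst x) (TO Z)" using Ide_left[OF Comp_Hom[OF pw i']] by simp
  then have "r \<cdot> i \<cdot> pw (Suc n) = Zero A (fst x) (fst x)" using r' X by (simp add: Hom_iff)
  then have "pw (Suc n) = Zero A (fst x) (fst x)"
    using Comp_assoc[OF pw i' r'] ri Ide_left[OF pw] by simp
  then obtain v where v: "v \<in> Hom A (fst x) (fst x)" "v \<cdot> u = Ide A (fst x)" "u \<cdot> v = Ide A (fst x)"
    unfolding pw_def by (rule one_minus_nilpotent_inverse[OF u' M uM])
  then show ?thesis using that hom_inverse[OF x x u v(1)] by simp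
qed

text \<open>No direct inverse of \<theta> is written down. Invertibility of the two composites gives
  \<theta> a right inverse \<open>\<psi> \<cdot> a\<close> and a left inverse
  \<open>b \<cdot> \<psi>\<close>, and these must coincide.\<close>

lemma retract_of_T_iso:
  assumes p: "cokernel_ext x B p" and Z: "Z \<in> Ob A" and i: "i \<in> mor x (T Z)"
    and r: "r \<in> mor (T Z) x"
    and ri: "r \<cdot> i = Ide A (fst x)"
  shows "isomorphic_obs E x (T B)"
proof -
  note P = cokernel_extD[OF p] and TZ = T_obs[OF Z] and qZ = cokernel_ext_T[OF Z]
  note x = P(1) and TB = T_obs[OF P(3)] and qB = cokernel_ext_T[OF P(3)]
  note fZ = free_ext_T[OF Z] and fB = free_ext_T[OF P(3)]
  have i': "i \<in> Hom A (fst x) (TO Z)" and r': "r \<in> Hom A (TO Z) (fst x)"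
    using hom_Hom[OF i] hom_Hom[OF r] by simp_all
  have \<iota>Z: "TI Z 0 \<in> Hom A Z (TO Z)" and \<pi>Z: "TP Z 0 \<in> Hom A (TO Z) Z"
    and \<pi>\<iota>Z: "TP Z 0 \<cdot> TI Z 0 = Ide A Z"
    using T_biproductD(2)[OF Z, of 0] T_biproductD(3)[OF Z, of 0] T_biproductD(4)[OF Z, of 0 0]
    by (simp_all add: T_summand_def)
  have \<iota>B: "TI B 0 \<in> Hom A B (TO B)" and \<pi>B: "TP B 0 \<in> Hom A (TO B) B"
    and \<pi>\<iota>B: "TP B 0 \<cdot> TI B 0 = Ide A B"
    using T_biproductD(2)[OF P(3), of 0] T_biproductD(3)[OF P(3), of 0]
      T_biproductD(4)[OF P(3), of 0 0]
    by (simp_all add: T_summand_def)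
  \<comment> \<open>\<open>ci\<close> and \<open>cr\<close> are C(i) and C(r); cancelling
    \<open>p\<close> turns \<open>r \<cdot> i = 1\<close> into
    \<open>cr \<cdot> ci = 1\<close>.\<close>
  obtain ci where ci: "ci \<in> Hom A B Z" "ci \<cdot> p = TP Z 0 \<cdot> i" using cokernel_ext_map[OF p qZ i] .
  obtain cr where cr: "cr \<in> Hom A Z B" "cr \<cdot> TP Z 0 = p \<cdot> r" using cokernel_ext_map[OF qZ p r] .
  have "(cr \<cdot> ci) \<cdot> p = cr \<cdot> TP Z 0 \<cdot> i" using Comp_assoc[OF P(2) ci(1) cr(1)] ci(2) by simp
  also have "\<dots> = (p \<cdot> r) \<cdot> i" using Comp_assoc[OF i' \<pi>Z cr(1)] cr(2) by simp
  also have "\<dots> = p" using Comp_assoc[OF i' r' P(2)] ri Ide_right[OF P(2)] by simp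
  finally have crci_p: "(cr \<cdot> ci) \<cdot> p = p" .
  have crci: "cr \<cdot> ci = Ide A B"
    using cokernel_extD(6)[OF p Comp_Hom[OF ci(1) cr(1)] Ide_Hom[OF P(3)]] crci_p Ide_left[OF P(2)]
      by simp
  \<comment> \<open>A section of \<open>p\<close>: the canonical section \<open>TI Z 0\<close> of
    \<open>TP Z 0\<close> is transported along the retraction, entering by \<open>ci\<close> and
    leaving by \<open>r\<close>.\<close>
  define \<sigma> where "\<sigma> = r \<cdot> TI Z 0 \<cdot> ci"
  have \<sigma>: "\<sigma> \<in> Hom A B (fst x)" unfolding \<sigma>_def using Comp_Hom[OF Comp_Hom[OF ci(1) \<iota>Z] r'] .
  have "p \<cdot> \<sigma> = (p \<cdot> r) \<cdot> TI Z 0 \<cdot> ci"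
    unfolding \<sigma>_def using Comp_assoc[OF Comp_Hom[OF ci(1) \<iota>Z] r' P(2)] by simp
  also have "\<dots> = cr \<cdot> (TP Z 0 \<cdot> TI Z 0) \<cdot> ci"
    using \<iota>Z \<pi>Z cr(1) ci(1) by (simp add: cr(2)[symmetric] Hom_iff)
  also have "\<dots> = Ide A B" using \<pi>\<iota>Z Ide_left[OF ci(1)] crci by simp
  finally have p\<sigma>: "p \<cdot> \<sigma> = Ide A B" .
  obtain \<theta> where \<theta>: "\<theta> \<in> mor (T B) x" "\<theta> \<cdot> TI B 0 = \<sigma>" using free_extD(4)[OF fB x \<sigma>] by blast
  \<comment> \<open>\<open>\<tau>\<close> is T(cr), obtained from the freeness of T(Z).\<close>
  obtain \<tau> where \<tau>: "\<tau> \<in> mor (T Z) (T B)" "\<tau> \<cdot> TI Z 0 = TI B 0 \<cdot> cr"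
    using free_extD(4)[OF fZ TB, of "TI B 0 \<cdot> cr"] Comp_Hom[OF cr(1) \<iota>B] by auto
  have \<theta>': "\<theta> \<in> Hom A (TO B) (fst x)" and \<tau>': "\<tau> \<in> Hom A (TO Z) (TO B)"
    using hom_Hom[OF \<theta>(1)] hom_Hom[OF \<tau>(1)] by simp_all
  \<comment> \<open>This says C(\<theta>) = 1 under C(T(B)) = B; the induced \<open>c\<close> is
    computed by restricting along the section \<open>TI B 0\<close>.\<close>
  have p\<theta>: "p \<cdot> \<theta> = TP B 0"
  proof -
    obtain c where c: "c \<in> Hom A B B" "c \<cdot> TP B 0 = p \<cdot> \<theta>" using cokernel_ext_map[OF qB p \<theta>(1)] .
    have "c = (c \<cdot> TP B 0) \<cdot> TI B 0"
      using Comp_assoc[OF \<iota>B \<pi>B c(1)] \<pi>\<iota>B Ide_right[OF c(1)] by simp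
    also have "\<dots> = Ide A B" using Comp_assoc[OF \<iota>B \<theta>' P(2)] c(2) \<theta>(2) p\<sigma> by simp
    finally show ?thesis using c(2) Ide_left[OF \<pi>B] by simp
  qed
  have \<pi>\<tau>: "TP B 0 \<cdot> \<tau> = cr \<cdot> TP Z 0"
  proof -
    obtain c where c: "c \<in> Hom A Z B" "c \<cdot> TP Z 0 = TP B 0 \<cdot> \<tau>"
      using cokernel_ext_map[OF qZ qB \<tau>(1)] .
    have "c = (c \<cdot> TP Z 0) \<cdot> TI Z 0"
      using Comp_assoc[OF \<iota>Z \<pi>Z c(1)] \<pi>\<iota>Z Ide_right[OF c(1)] by simp
    also have "\<dots> = TP B 0 \<cdot> TI B 0 \<cdot> cr" using Comp_assoc[OF \<iota>Z \<tau>' \<pi>B] c(2) \<tau>(2) by simp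
    also have "\<dots> = cr" using Comp_assoc[OF cr(1) \<iota>B \<pi>B] \<pi>\<iota>B Ide_left[OF cr(1)] by simp
    finally show ?thesis using c(2) by simp
  qed
  define \<psi> where "\<psi> = \<tau> \<cdot> i"
  have \<psi>: "\<psi> \<in> mor x (T B)" unfolding \<psi>_def using hom_Comp[OF x TZ TB i \<tau>(1)] .
  have \<psi>': "\<psi> \<in> Hom A (fst x) (TO B)" using hom_Hom[OF \<psi>] by simp
  \<comment> \<open>Likewise C(\<psi>) is C(\<tau>) after C(i), that is
    \<open>cr \<cdot> ci\<close>, hence the identity.\<close>
  have \<pi>\<psi>: "TP B 0 \<cdot> \<psi> = p"
  proof -
    have "TP B 0 \<cdot> \<psi> = (TP B 0 \<cdot> \<tau>) \<cdot> i" unfolding \<psi>_def using Comp_assoc[OF i' \<tau>' \<pi>B] by simp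
    also have "\<dots> = cr \<cdot> ci \<cdot> p" using \<pi>\<tau> Comp_assoc[OF i' \<pi>Z cr(1)] ci(2) by simp
    also have "\<dots> = p" using Comp_assoc[OF P(2) ci(1) cr(1)] crci_p by simp
    finally show ?thesis .
  qed
  have "p \<cdot> \<theta> \<cdot> \<psi> = p" using Comp_assoc[OF \<psi>' \<theta>' P(2)] p\<theta> \<pi>\<psi> by simp
  then obtain a where a: "a \<in> mor x x" "(\<theta> \<cdot> \<psi>) \<cdot> a = Ide A (fst x)"
    using retract_of_T_unipotent_iso[OF p Z i r ri hom_Comp[OF x TB x \<psi> \<theta>(1)]] by blast
  \<comment> \<open>For \<open>\<psi> \<cdot> \<theta>\<close> the object T(B) serves as a retract
    of itself, with identities in the roles of \<open>i\<close> and \<open>r\<close>.\<close>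
  have I: "Ide A (TO B) \<in> mor (T B) (T B)" using hom_Ide[OF TB] by simp
  have "TP B 0 \<cdot> \<psi> \<cdot> \<theta> = TP B 0" using Comp_assoc[OF \<theta>' \<psi>' \<pi>B] p\<theta> \<pi>\<psi> by simp
  moreover have "Ide A (TO B) \<cdot> Ide A (TO B) = Ide A (fst (T B))"
    using T_biproductD(1)[OF P(3)] by simp
  ultimately obtain b where b: "b \<in> mor (T B) (T B)" "b \<cdot> \<psi> \<cdot> \<theta> = Ide A (fst (T B))"
    using retract_of_T_unipotent_iso[OF qB P(3) I I _ hom_Comp[OF TB x TB \<theta>(1) \<psi>]] by blast
  have a': "a \<in> Hom A (fst x) (fst x)" and b': "b \<in> Hom A (TO B) (TO B)"
    using hom_Hom[OF a(1)] hom_Hom[OF b(1)] by simp_all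
  have r\<theta>: "\<theta> \<cdot> \<psi> \<cdot> a = Ide A (fst x)" using Comp_assoc[OF a' \<psi>' \<theta>'] a(2) by simp
  have l\<theta>: "(b \<cdot> \<psi>) \<cdot> \<theta> = Ide A (TO B)" using Comp_assoc[OF \<theta>' \<psi>' b'] b(2) by simp
  have eq: "b \<cdot> \<psi> = \<psi> \<cdot> a"
    using two_sided_inverse[OF \<theta>' Comp_Hom[OF \<psi>' b'] Comp_Hom[OF a' \<psi>'] l\<theta> r\<theta>] .
  have "b \<cdot> \<psi> \<in> mor x (T B)" using hom_Comp[OF x TB TB \<psi> b(1)] .
  then have "(x, T B, b \<cdot> \<psi>) \<in> Hom E x (T B)" "(T B, x, \<theta>) \<in> Hom E (T B) x"
    using x TB \<theta>(1) by simp_all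
  moreover have "(T B, x, \<theta>) \<cdot>\<^bsub>E\<^esub> (x, T B, b \<cdot> \<psi>) = Ide E x"
    "(x, T B, b \<cdot> \<psi>) \<cdot>\<^bsub>E\<^esub> (T B, x, \<theta>) = Ide E (T B)"
    using r\<theta> l\<theta> eq by simp_all
  ultimately show ?thesis using x TB unfolding isomorphic_obs_def E_simps(1) by blast
qed

section \<open>The criterion for membership in Add(T(Q))\<close>

lemma isomorphic_E_D:
  assumes "isomorphic_obs E x y"
  obtains \<gamma> \<delta> where "\<gamma> \<in> mor x y" "\<delta> \<in> mor y x" "\<delta> \<cdot> \<gamma> = Ide A (fst x)" "\<gamma> \<cdot> \<delta> = Ide A (fst y)"
  using assms unfolding isomorphic_obs_def by (auto elim!: Hom_E_cases)

lemma Add_T_iff: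
  assumes Q: "Q \<in> Ob A" and x: "x \<in> obs"
  shows "x \<in> Add E (T Q) \<longleftrightarrow> C_ob A n F x \<in> Add A Q \<and> isomorphic_obs E x (T (C_ob A n F x))"
proof -
  interpret E: category E by (rule category_E)
  obtain p where p: "cokernel_ext x (C_ob A n F x) p" using C_ob_cokernel_ext[OF x] .
  define B where "B = C_ob A n F x"
  note p = p[folded B_def]
  have B: "B \<in> Ob A" using cokernel_extD(3)[OF p] .
  show ?thesis
    unfolding B_def[symmetric]
  proof
    assume "x \<in> Add E (T Q)"
    then obtain J \<iota> w where w: "is_coproduct E (J :: ('o, 'm) ext_ar set) (\<lambda>_. T Q) \<iota> w"
      and sm: "is_direct_summand E x w"
      unfolding Add_def by blast
    have wo: "w \<in> obs" using w by (simp add: is_coproduct_def)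
    obtain q where q: "cokernel_ext w (C_ob A n F w) q" using C_ob_cokernel_ext[OF wo] .
    define Z where "Z = C_ob A n F w"
    note q = q[folded Z_def]
    have Z: "Z \<in> Ob A" using cokernel_extD(3)[OF q] .
    \<comment> \<open>As C(T(Q)) = Q, the image of the coproduct \<open>w\<close> under C is a
      coproduct of copies of \<open>Q\<close>, over the same index set.\<close>
    obtain c where c: "is_coproduct A J (\<lambda>_. Q) c Z"
      using cokernel_ext_coproduct[OF w cokernel_ext_T[OF Q] q] .
    obtain y \<iota>' where y: "is_coproduct E (UNIV :: bool set) (\<lambda>b. if b then x else y) \<iota>' w"
      using sm unfolding is_direct_summand_def by blast
    have yo: "y \<in> obs"
    proof -
      have "\<iota>' False \<in> Hom E y w" using coproduct_inj[OF y, of False] by simp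
      then show ?thesis by (rule Hom_E_cases)
    qed
    obtain p' where p': "cokernel_ext y (C_ob A n F y) p'" using C_ob_cokernel_ext[OF yo] .
    \<comment> \<open>C applied to the decomposition of \<open>w\<close> makes \<open>B\<close> a
      direct summand of \<open>Z\<close>.\<close>
    obtain c' where "is_coproduct A (UNIV :: bool set) (\<lambda>b. if b then B else C_ob A n F y) c' Z"
      by (rule cokernel_ext_coproduct[OF y _ q, where p = "\<lambda>b. if b then p else p'"
            and B = "\<lambda>b. if b then B else C_ob A n F y"]) (use p p' in auto)
    then have "is_direct_summand A B Z" unfolding is_direct_summand_def by blast
    then have 1: "B \<in> Add A Q" using AddI[OF B c] by simp
    \<comment> \<open>T(Z) and \<open>w\<close> are coproducts of the same family, hence isomorphic;
      this turns the retract \<open>x\<close> of \<open>w\<close> into a retract of T(Z).\<close>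
    obtain t where t: "is_coproduct E J (\<lambda>_. T Q) t (T Z)"
      using free_ext_coproduct[OF c free_ext_T[OF Q] free_ext_T[OF Z]] .
    have TZ: "T Z \<in> obs" by (rule T_obs[OF Z])
    obtain \<gamma> \<delta> where \<gamma>: "\<gamma> \<in> mor w (T Z)" and \<delta>: "\<delta> \<in> mor (T Z) w" and \<delta>\<gamma>: "\<delta> \<cdot> \<gamma> = Ide A (fst w)"
      using isomorphic_E_D[OF E.coproduct_isomorphic[OF w t]] .
    obtain i r where i: "i \<in> mor x w" and r: "r \<in> mor w x" and ri: "r \<cdot> i = Ide A (fst x)"
      using direct_summand_E_retract[OF sm] .
    note H = hom_Hom[OF i] hom_Hom[OF r] hom_Hom[OF \<gamma>] hom_Hom[OF \<delta>]
    have "(r \<cdot> \<delta>) \<cdot> \<gamma> \<cdot> i = r \<cdot> (\<delta> \<cdot> \<gamma>) \<cdot> i" using H by (simp add: Hom_iff)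
    also have "\<dots> = Ide A (fst x)" using \<delta>\<gamma> ri Ide_left[OF H(1)] by simp
    finally have "isomorphic_obs E x (T B)"
      using retract_of_T_iso[OF p Z hom_Comp[OF x wo TZ i \<gamma>] hom_Comp[OF TZ wo x \<delta> r]] by simp
    with 1 show "B \<in> Add A Q \<and> isomorphic_obs E x (T B)" by simp
  next
    assume "B \<in> Add A Q \<and> isomorphic_obs E x (T B)"
    then have iso: "isomorphic_obs E x (T B)" and "B \<in> Add A Q" by simp_all
    then obtain J c Z where c: "is_coproduct A (J :: 'm set) (\<lambda>_. Q) c Z"
      and "is_direct_summand A B Z"
      unfolding Add_def by blast
    then obtain Y d where d: "is_coproduct A (UNIV :: bool set) (\<lambda>b. if b then B else Y) d Z"
      unfolding is_direct_summand_def by blast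
    have Z: "Z \<in> Ob A" using c by (simp add: is_coproduct_def)
    have Y: "Y \<in> Ob A"
    proof -
      have "d False \<in> Hom A Y Z" using coproduct_inj[OF d, of False] by simp
      then show ?thesis by (rule Hom_Ob(1))
    qed
    obtain \<gamma> \<delta> where "\<gamma> \<in> mor x (T B)" "\<delta> \<in> mor (T B) x" "\<delta> \<cdot> \<gamma> = Ide A (fst x)"
      "\<gamma> \<cdot> \<delta> = Ide A (fst (T B))"
      using isomorphic_E_D[OF iso] .
    \<comment> \<open>Being free on \<open>B\<close>, the object \<open>x\<close> can take the place
      of T(B) when the decomposition of \<open>Z\<close> into \<open>B\<close> and \<open>Y\<close>
      is lifted to one of T(Z).\<close>
    then have fx: "free_ext x B (\<delta> \<cdot> TI B 0)" using free_ext_iso[OF free_ext_T[OF B] x] by blast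
    obtain t where t: "is_coproduct E J (\<lambda>_. T Q) t (T Z)"
      using free_ext_coproduct[OF c free_ext_T[OF Q] free_ext_T[OF Z]] .
    obtain s where "is_coproduct E (UNIV :: bool set) (\<lambda>b. if b then x else T Y) s (T Z)"
      by (rule free_ext_coproduct[OF d _ free_ext_T[OF Z], where x = "\<lambda>b. if b then x else T Y"
            and \<eta> = "\<lambda>b. if b then \<delta> \<cdot> TI B 0 else TI Y 0"]) (use fx free_ext_T[OF Y] in auto)
    then have "is_direct_summand E x (T Z)" unfolding is_direct_summand_def by blast
    then show "x \<in> Add E (T Q)" using E.AddI[OF _ t] x by simp
  qed
qed

end

theorem theorem3p1:
  fixes A :: "('o, 'm, 'x) preadditive_category_scheme"
    and n :: nat
    and F :: "nat \<Rightarrow> ('o, 'm) endofunctor"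
    and \<Phi> :: "nat \<Rightarrow> nat \<Rightarrow> 'o \<Rightarrow> 'm"
    and P X :: 'o
    and f :: "nat \<Rightarrow> 'm"
  assumes "abelian_category A"
    and "n \<ge> 1"
    and "\<And>i. i \<in> {1..n} \<Longrightarrow> endofunctor A (F i)"
    and "\<And>i. i \<in> {1..n} \<Longrightarrow> additive_functor A (F i)"
    and "\<And>i. i \<in> {1..n} \<Longrightarrow> right_exact A (F i)"
    and "\<And>i. i \<in> {1..n} \<Longrightarrow> \<exists>G. right_adjoint_to A (F i) G"
    and "\<And>i j. \<lbrakk>i \<in> {1..n}; j \<in> {1..n}; i + j \<in> {1..n}\<rbrakk>
           \<Longrightarrow> natural_transformation A (functor_comp (F i) (F j)) (F (i + j)) (\<Phi> i j)"
    and "associative_family A n F \<Phi>"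
    and "P \<in> Ob A"
    and "(X, f) \<in> Ob (trivial_extension A n F \<Phi>)"
  shows "(X, f) \<in> Add (trivial_extension A n F \<Phi>) (T_ob A n F \<Phi> P) \<longleftrightarrow>
     C_ob A n F (X, f) \<in> Add A P \<and>
     isomorphic_obs (trivial_extension A n F \<Phi>) (X, f) (T_ob A n F \<Phi> (C_ob A n F (X, f)))"
proof -
  interpret abelian_category A by fact
  have F: "additive_endofunctor A (F i)" if "i \<in> {1..n}" for i
    using preadditive_category_axioms assms(3,4)[OF that]
    by (intro additive_endofunctor.intro additive_endofunctor_axioms.intro)
  have "trivial_extension_data A n F \<Phi>"
    using abelian_category_axioms F assms(7,8)
    by (intro trivial_extension_data.intro trivial_extension_data_axioms.intro)
  then interpret trivial_extension_data A n F \<Phi> .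
  show ?thesis using Add_T_iff[OF assms(9)] assms(10) by simp
qed

end
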